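(* Let $G$ be a topological group and $Z\leq G$ its center. Let $V$ be a continuous weakly almost periodic (wap) Banach $G$-module such that $V^Z=\{0\}$. Then for every $n\geq 0$, $$\bar H_c^n(G,V)=0.$$
   Context: Banach spaces are over the real or complex numbers. A Banach $G$-module is a Banach space $V$ with a linear representation $\rho\colon G\to GL(V)$ by invertible bounded operators. It is continuous if for every $v\in V$ the map $g\mapsto\rho(g)v$ is continuous from $G$ to $V$ with the norm topology. It is weakly almost periodic (wap) if for every $v\in V$ the orbit $\rho(G)v$ is relatively weakly compact in $V$. For a subgroup $H\leq G$, $V^H$ is the subspace of vectors fixed by all $\rho(h)$, $h\in H$. Reduced continuous cohomology: for a topological group $G$ and a continuous Banach $G$-module $V$, let $C(G^{n+1},V)$ be the space of continuous maps $G^{n+1}\to V$ (norm topology on $V$), with the compact-open topology, and let $C(G^{n+1},V)^G$ be the subspace of $G$-equivariant maps, i.e. $c(gg_0,\dots,gg_n)=\rho(g)c(g_0,\dots,g_n)$. The differential $\partial\colon C(G^{n},V)^G\to C(G^{n+1},V)^G$ is $(\partial c)(g_0,\dots,g_n)=\sum_{k=0}^n(-1)^k c(g_0,\dots,\widehat{g_k},\dots,g_n)$; the complex $C(G^{*+1},V)^G$ starts in degree $0$ with $C(G,V)^G$. Let $Z^n(G,V)\subset C(G^{n+1},V)^G$ be the kernel of $\partial$ and $B^n(G,V)\subset C(G^{n+1},V)^G$ the image of $\partial$ (with $B^0=0$). Then $\bar H_c^n(G,V)=Z^n(G,V)/\overline{B^n(G,V)}$, the closure being in the compact-open topology. *)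

theory Defs
  imports "HOL-Analysis.Analysis"
begin

section \<open>Banach spaces over the real or complex numbers\<close>

text \<open>
  A single type class for the two possible scalar fields: every element is real, or the field is
  obtained from the reals by adjoining a square root of \<open>-1\<close>.
\<close>

class real_or_complex = real_normed_field +
  assumes real_or_complex:
    "(\<forall>x. \<exists>a. x = a *\<^sub>R 1) \<or>
     (\<exists>i. i * i = - 1 \<and> (\<forall>x. \<exists>a b. x = a *\<^sub>R 1 + b *\<^sub>R i))"

instance real :: real_or_complex
  by standard auto

instance complex :: real_or_complex
proof
  have "\<i> * \<i> = - 1 \<and> (\<forall>x. \<exists>a b. x = a *\<^sub>R 1 + b *\<^sub>R \<i>)"
    by (auto simp: complex_eq_iff)
  then show "(\<forall>x::complex. \<exists>a. x = a *\<^sub>R 1) \<or>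
     (\<exists>i::complex. i * i = - 1 \<and> (\<forall>x. \<exists>a b. x = a *\<^sub>R 1 + b *\<^sub>R i))"
    by blast
qed

text \<open>
  The class \<^class>\<open>banach\<close> only knows real scalars, so the scalar multiplication is a parameter.
\<close>

locale banach_space_over = vector_space scale
  for scale :: "'k::real_or_complex \<Rightarrow> 'v::banach \<Rightarrow> 'v" +
  assumes norm_scale: "norm (scale a v) = norm a * norm v"
    and scale_of_real: "scale (of_real r) v = r *\<^sub>R v"

lemma banach_space_over_real: "banach_space_over (scaleR :: real \<Rightarrow> 'v::banach \<Rightarrow> 'v)"
  by unfold_locales (simp_all add: scaleR_add_right scaleR_add_left)

lemma banach_space_over_complex: "banach_space_over ((*) :: complex \<Rightarrow> complex \<Rightarrow> complex)"
  by unfold_locales (simp_all add: algebra_simps norm_mult scaleR_conv_of_real)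

definition bounded_linear_over ::
  "('k::field \<Rightarrow> 'v::real_normed_vector \<Rightarrow> 'v) \<Rightarrow> ('k \<Rightarrow> 'w::real_normed_vector \<Rightarrow> 'w) \<Rightarrow> ('v \<Rightarrow> 'w) \<Rightarrow> bool"
  where "bounded_linear_over s t f \<longleftrightarrow>
    Vector_Spaces.linear s t f \<and> (\<exists>K. \<forall>v. norm (f v) \<le> norm v * K)"

definition weak_topology :: "('k::real_or_complex \<Rightarrow> 'v::banach \<Rightarrow> 'v) \<Rightarrow> 'v topology"
  where "weak_topology s = topology_generated_by
    {f -` U | f U. bounded_linear_over s (*) f \<and> open U}"

definition relatively_weakly_compact :: "('k::real_or_complex \<Rightarrow> 'v::banach \<Rightarrow> 'v) \<Rightarrow> 'v set \<Rightarrow> bool"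
  where "relatively_weakly_compact s A \<longleftrightarrow>
    compactin (weak_topology s) (weak_topology s closure_of A)"


section \<open>Banach modules\<close>

text \<open>
  Groups, not necessarily abelian, are written additively, following the classes
  \<^class>\<open>group_add\<close> and \<^class>\<open>topological_group_add\<close>.
\<close>

definition center :: "'g::group_add set"
  where "center = {z. \<forall>g. z + g = g + z}"

text \<open>Invertibility of the operators \<open>\<rho> g\<close> is a consequence: the inverse is \<open>\<rho> (- g)\<close>.\<close>

locale banach_module = banach_space_over scale
  for scale :: "'k::real_or_complex \<Rightarrow> 'v::banach \<Rightarrow> 'v" +
  fixes \<rho> :: "'g::group_add \<Rightarrow> 'v \<Rightarrow> 'v"
  assumes bounded_linear_action: "bounded_linear_over scale scale (\<rho> g)"
    and action_zero: "\<rho> 0 = id"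
    and action_add: "\<rho> (g + h) = \<rho> g \<circ> \<rho> h"

definition continuous_module :: "('g::topological_space \<Rightarrow> 'v::topological_space \<Rightarrow> 'v) \<Rightarrow> bool"
  where "continuous_module \<rho> \<longleftrightarrow> (\<forall>v. continuous_on UNIV (\<lambda>g. \<rho> g v))"

definition wap_module ::
  "('k::real_or_complex \<Rightarrow> 'v::banach \<Rightarrow> 'v) \<Rightarrow> ('g \<Rightarrow> 'v \<Rightarrow> 'v) \<Rightarrow> bool"
  where "wap_module s \<rho> \<longleftrightarrow> (\<forall>v. relatively_weakly_compact s (range (\<lambda>g. \<rho> g v)))"

definition fixed_vectors :: "('g \<Rightarrow> 'v \<Rightarrow> 'v) \<Rightarrow> 'g set \<Rightarrow> 'v set"
  where "fixed_vectors \<rho> H = {v. \<forall>h\<in>H. \<rho> h v = v}"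


section \<open>Reduced continuous cohomology\<close>

text \<open>
  Continuous maps on a space \<open>X\<close> with carrier \<^term>\<open>topspace X\<close> are represented by functions that
  vanish off the carrier, so that equality of maps is equality of functions and the vector space
  operations are pointwise.
\<close>

definition continuous_maps :: "'a topology \<Rightarrow> ('a \<Rightarrow> 'v::real_normed_vector) set"
  where "continuous_maps X =
    {c. continuous_map X euclidean c \<and> (\<forall>x. x \<notin> topspace X \<longrightarrow> c x = 0)}"

definition compact_open_topology :: "'a topology \<Rightarrow> ('a \<Rightarrow> 'v::real_normed_vector) topology"
  where "compact_open_topology X = topology_generated_by
    {{c \<in> continuous_maps X. c ` K \<subseteq> U} | K U. compactin X K \<and> open U}"

lemma topspace_compact_open_topology [simp]:
  "topspace (compact_open_topology X) = continuous_maps X"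
proof -
  have "{c \<in> continuous_maps X. c ` {} \<subseteq> UNIV}
      \<in> {{c \<in> continuous_maps X. c ` K \<subseteq> U} | K U. compactin X K \<and> open U}"
    by blast
  then show ?thesis
    by (fastforce simp: compact_open_topology_def topology_generated_by_topspace)
qed

text \<open>The power \<open>G\<^sup>m\<close>, whose points are the functions in \<^term>\<open>{..<m} \<rightarrow>\<^sub>E UNIV\<close>.\<close>

definition power_space :: "nat \<Rightarrow> (nat \<Rightarrow> 'g::topological_space) topology"
  where "power_space m = product_topology (\<lambda>_. euclidean) {..<m}"

definition translate :: "nat \<Rightarrow> 'g::group_add \<Rightarrow> (nat \<Rightarrow> 'g) \<Rightarrow> nat \<Rightarrow> 'g"
  where "translate m h x = (\<lambda>i\<in>{..<m}. h + x i)"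

text \<open>\<open>omit m k\<close> maps \<open>(x\<^sub>0, \<dots>, x\<^sub>m)\<close> to the \<open>m\<close>-tuple in which \<open>x\<^sub>k\<close> is left out.\<close>

definition omit :: "nat \<Rightarrow> nat \<Rightarrow> (nat \<Rightarrow> 'g) \<Rightarrow> nat \<Rightarrow> 'g"
  where "omit m k x = (\<lambda>i\<in>{..<m}. if i < k then x i else x (Suc i))"

text \<open>\<open>equivariant_maps \<rho> m\<close> is \<open>C(G\<^sup>m, V)\<^sup>G\<close>, so cochains of degree \<open>n\<close> have \<open>m = n + 1\<close>.\<close>

definition equivariant_maps ::
  "('g::topological_group_add \<Rightarrow> 'v::real_normed_vector \<Rightarrow> 'v) \<Rightarrow> nat \<Rightarrow> ((nat \<Rightarrow> 'g) \<Rightarrow> 'v) set"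
  where "equivariant_maps \<rho> m =
    {c \<in> continuous_maps (power_space m).
       \<forall>h. \<forall>x \<in> topspace (power_space m). c (translate m h x) = \<rho> h (c x)}"

text \<open>The differential from maps on \<open>G\<^sup>m\<close> to maps on \<open>G\<^sup>m\<^sup>+\<^sup>1\<close>.\<close>

definition differential ::
  "nat \<Rightarrow> ((nat \<Rightarrow> 'g::topological_space) \<Rightarrow> 'v::real_normed_vector) \<Rightarrow> (nat \<Rightarrow> 'g) \<Rightarrow> 'v"
  where "differential m c x =
    (if x \<in> topspace (power_space (Suc m))
     then \<Sum>k\<le>m. (- 1) ^ k *\<^sub>R c (omit m k x) else 0)"

definition cocycles ::
  "('g::topological_group_add \<Rightarrow> 'v::real_normed_vector \<Rightarrow> 'v) \<Rightarrow> nat \<Rightarrow> ((nat \<Rightarrow> 'g) \<Rightarrow> 'v) set"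
  where "cocycles \<rho> n = {c \<in> equivariant_maps \<rho> (Suc n). differential (Suc n) c = (\<lambda>_. 0)}"

definition coboundaries ::
  "('g::topological_group_add \<Rightarrow> 'v::real_normed_vector \<Rightarrow> 'v) \<Rightarrow> nat \<Rightarrow> ((nat \<Rightarrow> 'g) \<Rightarrow> 'v) set"
  where "coboundaries \<rho> n =
    (if n = 0 then {\<lambda>_. 0} else differential n ` equivariant_maps \<rho> n)"

definition closed_coboundaries ::
  "('g::topological_group_add \<Rightarrow> 'v::real_normed_vector \<Rightarrow> 'v) \<Rightarrow> nat \<Rightarrow> ((nat \<Rightarrow> 'g) \<Rightarrow> 'v) set"
  where "closed_coboundaries \<rho> n =
    compact_open_topology (power_space (Suc n)) closure_of coboundaries \<rho> n"

text \<open>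
  The quotient of the cocycles by \<^const>\<open>closed_coboundaries\<close>, as a set of cosets; its zero element
  is the coset \<open>closed_coboundaries \<rho> n\<close>.
\<close>

definition reduced_cohomology ::
  "('g::topological_group_add \<Rightarrow> 'v::real_normed_vector \<Rightarrow> 'v) \<Rightarrow> nat \<Rightarrow> ((nat \<Rightarrow> 'g) \<Rightarrow> 'v) set set"
  where "reduced_cohomology \<rho> n =
    (\<lambda>c. {\<lambda>x. c x + b x | b. b \<in> closed_coboundaries \<rho> n}) ` cocycles \<rho> n"

end

theory Submission
  imports Defs
begin

text \<open>
  A central element \<open>z\<close> acts trivially on cohomology: for a cocycle \<open>c\<close>, the prism operator exhibits
  \<open>\<rho> z \<circ> c - c\<close>, which is the difference of \<open>c\<close> and its translate by \<open>z\<close>, as a coboundary. So \<open>c\<close> is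
  cohomologous to \<open>a \<circ> c\<close> for every convex combination \<open>a\<close> of the operators \<open>\<rho> z\<close>, and it suffices
  to find such an \<open>a\<close> that is uniformly small on a given compact set. As the \<open>\<rho> z\<close> commute and are
  uniformly bounded, this reduces to a single vector \<open>v\<close>. If the norms of all \<open>a v\<close> were bounded
  below, the Hahn-Banach theorem would provide an invariant functional \<open>f\<close> with \<open>f v \<noteq> 0\<close>, and an
  invariant mean over the orbit of \<open>v\<close>, that is, an invariant element \<open>w\<close> of the bidual with
  \<open>w f = f v\<close>. By Krein's theorem \<open>w\<close> is given by a vector of \<open>V\<close>, because the orbit of \<open>v\<close> is
  relatively weakly compact. This vector is fixed by the center and nonzero, a contradiction.

  Krein's theorem is proved by Whitley's and Simons' arguments. If \<open>w\<close> is not a vector, then by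
  Helly's theorem there are functionals \<open>g n\<close> in the dual ball on which \<open>w\<close> is bounded below and which
  vanish on finer and finer finite nets of the weakly compact set \<open>K\<close>. They converge to zero pointwise
  on \<open>K\<close>, while Simons' inequality, whose proof only uses that functionals attain their supremum on
  \<open>K\<close>, forbids this.
\<close>

section \<open>The Hahn-Banach theorem\<close>

text \<open>Homogeneity is demanded as one inequality only; the other follows by scaling with
  \<open>1 / t\<close>. One-sided conditions are easier to check for infima and suprema.\<close>

definition sublinear :: "('a::real_vector \<Rightarrow> real) \<Rightarrow> bool"
  where "sublinear p \<longleftrightarrow> (\<forall>x y. p (x + y) \<le> p x + p y) \<and> (\<forall>t>0. \<forall>x. p (t *\<^sub>R x) \<le> t * p x)"

lemma sublinear_add: "sublinear p \<Longrightarrow> p (x + y) \<le> p x + p y"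
  by (simp add: sublinear_def)

lemma sublinear_scaleR:
  assumes "sublinear p" "t > 0"
  shows "p (t *\<^sub>R x) = t * p x"
proof (rule antisym)
  show "p (t *\<^sub>R x) \<le> t * p x"
    using assms by (simp add: sublinear_def)
  have "p (inverse t *\<^sub>R (t *\<^sub>R x)) \<le> inverse t * p (t *\<^sub>R x)"
    using assms unfolding sublinear_def by (meson positive_imp_inverse_positive)
  then have "p x \<le> inverse t * p (t *\<^sub>R x)"
    using assms by simp
  then show "t * p x \<le> p (t *\<^sub>R x)"
    using assms by (simp add: field_simps)
qed

lemma sublinear_zero: "sublinear p \<Longrightarrow> p 0 = 0"
  using sublinear_scaleR[of p 2 0] by simp

lemma sublinear_uminus_ge: "sublinear p \<Longrightarrow> - p (- x) \<le> p x"
  using sublinear_add[of p x "- x"] by (simp add: sublinear_zero)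

text \<open>For negative \<open>t\<close> this reduces to \<open>- p (- x) \<le> p x\<close>. It
  shows that \<open>t * p x\<close> is a linear functional dominated by \<open>p\<close> on the line
  through \<open>x\<close>.\<close>

lemma sublinear_scaleR_ge:
  assumes "sublinear p"
  shows "t * p x \<le> p (t *\<^sub>R x)"
proof (cases t "0::real" rule: linorder_cases)
  case less
  then have "p ((- t) *\<^sub>R x) = - t * p x"
    using assms by (intro sublinear_scaleR) auto
  then show ?thesis
    using sublinear_uminus_ge[OF assms, of "t *\<^sub>R x"] by simp
qed (use assms in \<open>auto simp: sublinear_zero sublinear_scaleR\<close>)

lemma sublinear_norm: "sublinear norm"
  by (auto simp: sublinear_def norm_triangle_ineq)

lemma sublinear_mult: "sublinear p \<Longrightarrow> c \<ge> 0 \<Longrightarrow> sublinear (\<lambda>x. c * p x)"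
  unfolding sublinear_def
  by (metis distrib_left mult.left_commute mult_left_mono)

text \<open>The index \<open>k\<close> may depend on both given indices, so the rule serves infimal
  convolutions, chains, upper limits and means over a commuting semigroup alike.\<close>

lemma sublinear_INF:
  assumes "I \<noteq> {}" and bdd: "\<And>x. bdd_below ((\<lambda>i. F i x) ` I)"
    and add: "\<And>i j x y. i \<in> I \<Longrightarrow> j \<in> I \<Longrightarrow> \<exists>k\<in>I. F k (x + y) \<le> F i x + F j y"
    and scale: "\<And>i t x. i \<in> I \<Longrightarrow> t > 0 \<Longrightarrow> \<exists>k\<in>I. F k (t *\<^sub>R x) \<le> t * F i x"
  shows "sublinear (\<lambda>x. INF i\<in>I. F i x)"
proof -
  have lower: "(INF i\<in>I. F i x) \<le> F k x" if "k \<in> I" for k x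
    using bdd that by (rule cINF_lower)
  have "(INF i\<in>I. F i (x + y)) \<le> (INF i\<in>I. F i x) + (INF i\<in>I. F i y)" for x y
  proof -
    have "(INF k\<in>I. F k (x + y)) - F i x \<le> F j y" if "i \<in> I" "j \<in> I" for i j
      using add[OF that, of x y] lower[of _ "x + y"] by (smt (verit))
    then have "(INF k\<in>I. F k (x + y)) - F i x \<le> (INF j\<in>I. F j y)" if "i \<in> I" for i
      using assms(1) that by (intro cINF_greatest)
    then have "(INF k\<in>I. F k (x + y)) - (INF j\<in>I. F j y) \<le> (INF i\<in>I. F i x)"
      using assms(1) by (intro cINF_greatest) (auto simp: algebra_simps)
    then show ?thesis
      by simp
  qed
  moreover have "(INF i\<in>I. F i (t *\<^sub>R x)) \<le> t * (INF i\<in>I. F i x)" if "t > 0" for t x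
  proof -
    have "inverse t * (INF k\<in>I. F k (t *\<^sub>R x)) \<le> F i x" if "i \<in> I" for i
      using scale[OF that \<open>t > 0\<close>, of x] lower[of _ "t *\<^sub>R x"] \<open>t > 0\<close>
      by (auto simp: field_simps intro: order_trans)
    then have "inverse t * (INF k\<in>I. F k (t *\<^sub>R x)) \<le> (INF i\<in>I. F i x)"
      using assms(1) by (intro cINF_greatest)
    then show ?thesis
      using that by (simp add: field_simps)
  qed
  ultimately show ?thesis
    by (auto simp: sublinear_def)
qed

text \<open>The minorant is the infimal convolution \<open>q x = inf (p (x - i m) + f m)\<close>
  over \<open>M\<close>. It turns the condition that \<open>f\<close> lies below \<open>p\<close>
  into an upper bound for \<open>q\<close>, so that every linear functional below \<open>q\<close>
  extends \<open>f\<close>.\<close>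

lemma sublinear_minorant_extension:
  fixes p :: "'a::real_vector \<Rightarrow> real" and i :: "'b::real_vector \<Rightarrow> 'a"
  assumes p: "sublinear p" and M: "subspace M" and "linear i" "linear f"
    and le: "\<And>m. m \<in> M \<Longrightarrow> f m \<le> p (i m)"
  shows "\<exists>q. sublinear q \<and> q \<le> p \<and> (\<forall>m\<in>M. q (i m) \<le> f m)"
proof -
  interpret i: linear i by fact
  interpret f: linear f by fact
  define F where "F m x = p (x - i m) + f m" for m x
  \<comment> \<open>The hypothesis on \<open>f\<close> at \<open>- m\<close> bounds the family
    below, so that its infimum is a genuine one.\<close>
  have ge: "- p (- x) \<le> F m x" if "m \<in> M" for m x
  proof -
    have "f (- m) \<le> p (i (- m))"
      using le M that by (meson subspace_neg)
    also have "p (i (- m)) \<le> p (x - i m) + p (- x)"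
      using sublinear_add[OF p, of "x - i m" "- x"] by (simp add: i.neg)
    finally show ?thesis
      by (simp add: F_def f.neg)
  qed
  have 0: "0 \<in> M"
    using M by (rule subspace_0)
  have bdd: "bdd_below ((\<lambda>m. F m x) ` M)" for x
    using ge by (intro bdd_belowI2)
  have "sublinear (\<lambda>x. INF m\<in>M. F m x)"
  proof (rule sublinear_INF)
    show "\<exists>k\<in>M. F k (x + y) \<le> F m x + F n y" if "m \<in> M" "n \<in> M" for m n x y
      using sublinear_add[OF p, of "x - i m" "y - i n"] that
      by (intro bexI[of _ "m + n"]) (auto simp: F_def i.add f.add algebra_simps subspace_add[OF M])
    show "\<exists>k\<in>M. F k (t *\<^sub>R x) \<le> t * F m x" if "m \<in> M" "t > 0" for m t x
      using sublinear_scaleR[OF p that(2), of "x - i m"] that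
      by (intro bexI[of _ "t *\<^sub>R m"])
        (auto simp: F_def i.scaleR f.scaleR algebra_simps subspace_scale[OF M])
  qed (use 0 bdd in auto)
  moreover have "(INF m\<in>M. F m x) \<le> p x" for x
    using cINF_lower[OF bdd 0, of x] by (simp add: F_def i.zero f.zero)
  moreover have "(INF k\<in>M. F k (i m)) \<le> f m" if "m \<in> M" for m
    using cINF_lower[OF bdd that, of "i m"] by (simp add: F_def sublinear_zero[OF p])
  ultimately show ?thesis
    by (auto simp: le_fun_def intro!: exI[of _ "\<lambda>x. INF m\<in>M. F m x"])
qed

text \<open>Zorn's lemma for the reversed order. The infimum of a chain is sublinear because a chain
  is directed, and finite because every sublinear \<open>q \<le> p\<close> satisfies
  \<open>q x \<ge> - p (- x)\<close>.\<close>

lemma minimal_sublinear_exists: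
  assumes "sublinear p"
  shows "\<exists>q. sublinear q \<and> q \<le> p \<and> (\<forall>r. sublinear r \<longrightarrow> r \<le> q \<longrightarrow> r = q)"
proof -
  define A where "A = {q. sublinear q \<and> q \<le> p}"
  have "\<exists>m\<in>A. \<forall>a\<in>A. a \<le> m \<longrightarrow> a = m"
  proof (rule predicate_Zorn)
    show "partial_order_on A (relation_of (\<lambda>a b. b \<le> a) A)"
      by (rule partial_order_on_relation_ofI) auto
  next
    fix C assume "C \<in> Chains (relation_of (\<lambda>a b. b \<le> a) A)"
    then have C: "C \<subseteq> A" and chain: "\<And>a b. a \<in> C \<Longrightarrow> b \<in> C \<Longrightarrow> a \<le> b \<or> b \<le> a"
      by (auto simp: Chains_def relation_of_def)
    show "\<exists>u\<in>A. \<forall>a\<in>C. u \<le> a"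
    proof (cases "C = {}")
      case True
      then show ?thesis
        using assms by (auto simp: A_def)
    next
      case False
      have bdd: "bdd_below ((\<lambda>q. q x) ` C)" for x
      proof (rule bdd_belowI2)
        fix q assume "q \<in> C"
        with C have "sublinear q" "q (- x) \<le> p (- x)"
          by (auto simp: A_def le_fun_def)
        then show "- p (- x) \<le> q x"
          using sublinear_uminus_ge[of q x] by simp
      qed
      have lower: "(INF q\<in>C. q x) \<le> a x" if "a \<in> C" for a x
        using bdd that by (rule cINF_lower)
      have "sublinear (\<lambda>x. INF q\<in>C. q x)"
      proof (rule sublinear_INF)
        fix a b x y assume ab: "a \<in> C" "b \<in> C"
        then have sub: "sublinear a" "sublinear b"
          using C by (auto simp: A_def)
        from chain[OF ab] show "\<exists>k\<in>C. k (x + y) \<le> a x + b y"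
        proof
          assume "a \<le> b"
          then show ?thesis
            using sublinear_add[OF sub(1), of x y] ab
            by (intro bexI[of _ a]) (auto simp: le_fun_def intro: order_trans)
        next
          assume "b \<le> a"
          then show ?thesis
            using sublinear_add[OF sub(2), of x y] ab
            by (intro bexI[of _ b]) (auto simp: le_fun_def intro: order_trans)
        qed
      next
        show "\<exists>k\<in>C. k (t *\<^sub>R x) \<le> t * a x" if "a \<in> C" "t > 0" for a t x
          using that C by (intro bexI[of _ a]) (auto simp: A_def sublinear_scaleR)
      qed (use False bdd in auto)
      moreover have "(\<lambda>x. INF q\<in>C. q x) \<le> p"
      proof -
        obtain a where "a \<in> C"
          using False by auto
        then have "a \<le> p"
          using C by (auto simp: A_def)
        then show ?thesis
          using lower[OF \<open>a \<in> C\<close>] by (auto simp: le_fun_def intro: order_trans)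
      qed
      ultimately show ?thesis
        using lower by (intro bexI[of _ "\<lambda>x. INF q\<in>C. q x"]) (auto simp: A_def le_fun_def)
    qed
  qed
  then show ?thesis
    by (auto simp: A_def intro: order_trans)
qed

text \<open>A minimal sublinear functional is odd, and for an odd one each inequality applied to
  negatives gives its reverse, so it is linear.\<close>

lemma linear_below_sublinear:
  fixes p :: "'a::real_vector \<Rightarrow> real"
  assumes "sublinear p"
  shows "\<exists>f. linear f \<and> f \<le> p"
proof -
  obtain q where q: "sublinear q" "q \<le> p" and min: "\<And>r. sublinear r \<Longrightarrow> r \<le> q \<Longrightarrow> r = q"
    using minimal_sublinear_exists[OF assms] by blast
  have neg: "q (- x) = - q x" for x
  proof -
    \<comment> \<open>\<open>q\<close> has a sublinear minorant that is linear on the line through \<open>x\<close>, and equals it by minimality\<close>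
    have "\<exists>r. sublinear r \<and> r \<le> q \<and> (\<forall>t\<in>UNIV. r (t *\<^sub>R x) \<le> t * q x)"
      by (rule sublinear_minorant_extension[OF q(1), of UNIV "\<lambda>t. t *\<^sub>R x" "\<lambda>t. t * q x"])
        (auto intro!: linearI simp: algebra_simps sublinear_scaleR_ge[OF q(1)])
    then have "q (t *\<^sub>R x) \<le> t * q x" for t
      using min by auto
    from this[of "-1"] show ?thesis
      using sublinear_uminus_ge[OF q(1), of x] by simp
  qed
  have "linear q"
  proof (rule linearI)
    show "q (x + y) = q x + q y" for x y
      using sublinear_add[OF q(1), of x y] sublinear_add[OF q(1), of "- x" "- y"] neg[of x] neg[of y]
        neg[of "x + y"] by simp
    show "q (t *\<^sub>R x) = t *\<^sub>R q x" for t x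
      using sublinear_scaleR_ge[OF q(1), of t x] sublinear_scaleR_ge[OF q(1), of t "- x"]
        neg[of x] neg[of "t *\<^sub>R x"] by simp
  qed
  with q(2) show ?thesis
    by blast
qed

text \<open>A linear \<open>g\<close> below the infimal convolution satisfies
  \<open>g (i m) \<le> f m\<close>; replacing \<open>m\<close> by \<open>- m\<close> yields
  equality.\<close>

theorem hahn_banach_extension:
  fixes p :: "'a::real_vector \<Rightarrow> real" and i :: "'b::real_vector \<Rightarrow> 'a"
  assumes "sublinear p" and M: "subspace M" and "linear i" "linear f"
    and "\<And>m. m \<in> M \<Longrightarrow> f m \<le> p (i m)"
  obtains g where "linear g" "\<And>x. g x \<le> p x" "\<And>m. m \<in> M \<Longrightarrow> g (i m) = f m"
proof -
  obtain q where q: "sublinear q" "q \<le> p" "\<And>m. m \<in> M \<Longrightarrow> q (i m) \<le> f m"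
    using sublinear_minorant_extension[OF assms] by blast
  obtain g where g: "linear g" "g \<le> q"
    using linear_below_sublinear[OF q(1)] by blast
  have le: "g (i m) \<le> f m" if "m \<in> M" for m
    using g(2) q(3)[OF that] by (auto simp: le_fun_def intro: order_trans)
  have "g (i m) = f m" if "m \<in> M" for m
    using le[OF that] le[of "- m"] M that
    by (auto simp: linear_neg[OF assms(3)] linear_neg[OF assms(4)] linear_neg[OF g(1)] subspace_neg)
  with g q(2) show thesis
    by (intro that[of g]) (auto simp: le_fun_def intro: order_trans)
qed

corollary hahn_banach_point:
  fixes p :: "'a::real_vector \<Rightarrow> real"
  assumes "sublinear p"
  obtains g where "linear g" "\<And>x. g x \<le> p x" "g y = p y"
proof (rule hahn_banach_extension[of p UNIV "\<lambda>t. t *\<^sub>R y" "\<lambda>t. t * p y"])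
  fix g assume "linear g" "\<And>x. g x \<le> p x" "\<And>t. t \<in> UNIV \<Longrightarrow> g (t *\<^sub>R y) = t * p y"
  then show thesis
    using that[of g] by (metis UNIV_I mult_1 scaleR_one)
qed (use assms in \<open>auto intro!: linearI simp: algebra_simps sublinear_scaleR_ge\<close>)

section \<open>Continuous real functionals\<close>

lemma linear_le_norm_imp_blinfun:
  fixes f :: "'a::real_normed_vector \<Rightarrow> real"
  assumes "linear f" "\<And>x. f x \<le> c * norm x"
  shows "\<exists>g. (\<forall>x. blinfun_apply g x = f x) \<and> norm g \<le> \<bar>c\<bar>"
proof -
  interpret f: linear f by fact
  have abs: "\<bar>f x\<bar> \<le> \<bar>c\<bar> * norm x" for x
    using assms(2)[of x] assms(2)[of "- x"] abs_ge_self[of c] mult_right_mono[of c "\<bar>c\<bar>" "norm x"]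
    by (auto simp: f.neg abs_le_iff)
  then have bl: "bounded_linear f"
    by (intro bounded_linear_intro[of f "\<bar>c\<bar>"]) (auto simp: f.add f.scaleR mult.commute)
  show ?thesis
    using abs by (intro exI[of _ "Blinfun f"])
      (auto simp: bounded_linear_Blinfun_apply[OF bl] intro!: norm_blinfun_bound)
qed

lemma norming_functional:
  fixes y :: "'a::real_normed_vector"
  obtains g :: "'a \<Rightarrow>\<^sub>L real" where "norm g \<le> 1" "g y = norm y"
proof -
  obtain f where f: "linear f" "\<And>x. f x \<le> norm x" "f y = norm y"
    using hahn_banach_point[OF sublinear_norm] by metis
  then obtain g :: "'a \<Rightarrow>\<^sub>L real" where "\<forall>x. g x = f x" "norm g \<le> \<bar>1\<bar>"
    using linear_le_norm_imp_blinfun[of f 1] by auto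
  with f that[of g] show thesis
    by simp
qed

lemma blinfun_separates:
  fixes x y :: "'a::real_normed_vector"
  assumes "\<And>g :: 'a \<Rightarrow>\<^sub>L real. g x = g y"
  shows "x = y"
proof -
  obtain g :: "'a \<Rightarrow>\<^sub>L real" where "g (x - y) = norm (x - y)"
    by (rule norming_functional)
  with assms[of g] show ?thesis
    by (simp add: blinfun.diff_right)
qed

section \<open>The uniform boundedness principle\<close>

text \<open>Baire's theorem provides a ball of radius \<open>r\<close> on which all of
  \<open>F\<close> is bounded by some \<open>n\<close>. Differences of two points of the ball give
  the bound \<open>2 * n / r\<close>.\<close>

theorem uniform_boundedness:
  fixes F :: "('a::banach \<Rightarrow>\<^sub>L 'b::real_normed_vector) set"
  assumes bdd: "\<And>x. bounded ((\<lambda>f. blinfun_apply f x) ` F)"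
  shows "bounded F"
proof -
  define E where "E n = {x. \<forall>f\<in>F. norm (blinfun_apply f x) \<le> real n}" for n :: nat
  have "closed (E n)" for n
  proof -
    have "E n = (\<Inter>f\<in>F. {x. norm (blinfun_apply f x) \<le> real n})"
      by (auto simp: E_def)
    then show ?thesis
      by (auto intro!: closed_INT closed_Collect_le continuous_intros)
  qed
  have "x \<in> \<Union>(range E)" for x
  proof -
    obtain B where B: "\<And>f. f \<in> F \<Longrightarrow> norm (blinfun_apply f x) \<le> B"
      using bdd[of x] unfolding bounded_iff by auto
    obtain n where "B \<le> real n"
      using real_arch_simple by blast
    with B have "x \<in> E n"
      unfolding E_def by (auto intro: order_trans)
    then show ?thesis
      by auto
  qed
  then have "\<Union>(range E) = UNIV"
    by auto
  moreover have "euclidean interior_of \<Union>(range E) = {}" if "\<And>n. interior (E n) = {}"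
    by (rule Baire_category_alt)
      (use that \<open>\<And>n. closed (E n)\<close> in \<open>auto simp: completely_metrizable_space_euclidean\<close>)
  ultimately obtain n where "interior (E n) \<noteq> {}"
    by fastforce
  then obtain x r where r: "r > 0" "cball x r \<subseteq> E n"
    by (meson all_not_in_conv mem_interior_cball)
  have "norm f \<le> 2 * real n / r" if "f \<in> F" for f
  proof (rule norm_blinfun_bound)
    fix y
    show "norm (blinfun_apply f y) \<le> 2 * real n / r * norm y"
    proof (cases "y = 0")
      case False
      define t where "t = r / norm y"
      have "t > 0"
        using r False by (simp add: t_def)
      have "x + t *\<^sub>R y \<in> cball x r" "x \<in> cball x r"
        using r False by (auto simp: dist_norm t_def)
      then have "norm (blinfun_apply f (x + t *\<^sub>R y)) \<le> n" "norm (blinfun_apply f x) \<le> n"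
        using subsetD[OF r(2)] that by (auto simp: E_def)
      then have "norm (blinfun_apply f (t *\<^sub>R y)) \<le> 2 * real n"
        using norm_triangle_ineq4[of "blinfun_apply f (x + t *\<^sub>R y)" "blinfun_apply f x"]
        by (simp add: blinfun.add_right)
      then have "t * norm (blinfun_apply f y) \<le> 2 * real n"
        using \<open>t > 0\<close> by (simp add: blinfun.scaleR_right)
      then show ?thesis
        using r False by (simp add: t_def field_simps)
    qed simp
  qed (use r in auto)
  then show ?thesis
    by (auto simp: bounded_iff)
qed

text \<open>The uniform boundedness principle is applied to the evaluations on the dual, which is
  complete even if the space is not; norming functionals recover \<open>norm x\<close> from the norm
  of the evaluation.\<close>

lemma weakly_bounded_imp_bounded:
  fixes S :: "'a::real_normed_vector set"
  assumes "\<And>g :: 'a \<Rightarrow>\<^sub>L real. bounded (blinfun_apply g ` S)"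
  shows "bounded S"
proof -
  define ev where "ev x = Blinfun (\<lambda>g :: 'a \<Rightarrow>\<^sub>L real. blinfun_apply g x)" for x
  have ev: "blinfun_apply (ev x) g = blinfun_apply g x" for x g
    unfolding ev_def by (simp add: bounded_linear_Blinfun_apply blinfun.bounded_linear_left)
  have "bounded (ev ` S)"
    by (rule uniform_boundedness) (use assms in \<open>simp add: image_image ev\<close>)
  then obtain B where B: "\<And>x. x \<in> S \<Longrightarrow> norm (ev x) \<le> B"
    by (auto simp: bounded_iff)
  have "norm x \<le> B" if "x \<in> S" for x
  proof -
    obtain g :: "'a \<Rightarrow>\<^sub>L real" where g: "norm g \<le> 1" "blinfun_apply g x = norm x"
      by (rule norming_functional)
    have "norm x \<le> norm (ev x) * norm g"
      using norm_blinfun[of "ev x" g] g(2) by (simp add: ev)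
    also have "\<dots> \<le> norm (ev x) * 1"
      using g(1) by (intro mult_left_mono) auto
    finally show ?thesis
      using B[OF that] by simp
  qed
  then show ?thesis
    by (auto simp: bounded_iff)
qed

section \<open>Krein's theorem\<close>

text \<open>A functional that vanishes on the common kernel of finitely many evaluations is a
  combination of them, hence again an evaluation. In the induction a multiple of the evaluation at
  \<open>y\<close> is subtracted.\<close>

lemma functional_in_span_evaluations:
  fixes w :: "('a::real_normed_vector \<Rightarrow>\<^sub>L real) \<Rightarrow> real"
  assumes "finite X" "linear w"
    and "\<And>g. (\<forall>x\<in>X. blinfun_apply g x = 0) \<Longrightarrow> w g = 0"
  shows "\<exists>x. \<forall>g. w g = blinfun_apply g x"
  using assms
proof (induction X arbitrary: w rule: finite_induct)
  case empty
  then show ?case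
    by (intro exI[of _ 0]) auto
next
  case (insert y X)
  interpret w: linear w by fact
  show ?case
  proof (cases "\<exists>h :: 'a \<Rightarrow>\<^sub>L real. (\<forall>x\<in>X. blinfun_apply h x = 0) \<and> blinfun_apply h y \<noteq> 0")
    case False
    then have "w g = 0" if "\<forall>x\<in>X. blinfun_apply g x = 0" for g
      using that by (intro insert.prems(2)) blast
    with insert.IH[OF insert.prems(1)] show ?thesis
      by blast
  next
    case True
    then obtain h :: "'a \<Rightarrow>\<^sub>L real" where h: "\<forall>x\<in>X. blinfun_apply h x = 0" "blinfun_apply h y \<noteq> 0"
      by blast
    \<comment> \<open>This choice makes the corrected functional vanish at \<open>h\<close>; below,
      \<open>t\<close> is chosen so that \<open>g - t *\<^sub>R h\<close> vanishes at
      \<open>y\<close> as well.\<close>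
    define c where "c = w h / blinfun_apply h y"
    have "\<exists>x. \<forall>g. w g - c * blinfun_apply g y = blinfun_apply g x"
    proof (rule insert.IH)
      show "linear (\<lambda>g. w g - c * blinfun_apply g y)"
        by (rule linearI)
          (auto simp: w.add w.scaleR blinfun.add_left blinfun.scaleR_left algebra_simps)
      show "w g - c * blinfun_apply g y = 0" if g: "\<forall>x\<in>X. blinfun_apply g x = 0" for g
      proof -
        define t where "t = blinfun_apply g y / blinfun_apply h y"
        have "w (g - t *\<^sub>R h) = 0"
          using g h by (intro insert.prems(2))
            (auto simp: blinfun.diff_left blinfun.scaleR_left t_def)
        then show ?thesis
          by (simp add: w.diff w.scaleR t_def c_def field_simps)
      qed
    qed
    then obtain x where x: "\<And>g. w g - c * blinfun_apply g y = blinfun_apply g x"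
      by blast
    have "w g = blinfun_apply g (x + c *\<^sub>R y)" for g
      using x[of g] by (simp add: blinfun.add_right blinfun.scaleR_right)
    then show ?thesis
      by blast
  qed
qed

text \<open>The space is closed in its bidual: by norming functionals, approximating vectors with
  errors \<open>1 / (n + 1)\<close> form a Cauchy sequence, and \<open>w\<close> is evaluation at
  its limit.\<close>

lemma evaluation_if_approximable:
  fixes w :: "('a::banach \<Rightarrow>\<^sub>L real) \<Rightarrow> real"
  assumes "\<And>e. e > 0 \<Longrightarrow> \<exists>x. \<forall>g. norm g \<le> 1 \<longrightarrow> \<bar>w g - blinfun_apply g x\<bar> \<le> e"
    and "linear w"
  shows "\<exists>x. \<forall>g. w g = blinfun_apply g x"
proof -
  interpret w: linear w by fact
  have "\<forall>n. \<exists>x. \<forall>g. norm g \<le> 1 \<longrightarrow> \<bar>w g - blinfun_apply g x\<bar> \<le> 1 / real (Suc n)"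
    using assms(1) by simp
  then obtain x where x: "\<And>n g. norm g \<le> 1 \<Longrightarrow> \<bar>w g - blinfun_apply g (x n)\<bar> \<le> 1 / real (Suc n)"
    by metis
  have le: "norm (x m - x n) \<le> 1 / real (Suc m) + 1 / real (Suc n)" for m n
  proof -
    obtain g :: "'a \<Rightarrow>\<^sub>L real" where "norm g \<le> 1" "blinfun_apply g (x m - x n) = norm (x m - x n)"
      by (rule norming_functional)
    then show ?thesis
      using x[of g m] x[of g n] by (simp add: blinfun.diff_right abs_le_iff)
  qed
  have "Cauchy x"
  proof (rule CauchyI)
    fix e :: real assume "e > 0"
    then obtain N where N: "1 / real (Suc N) < e / 2"
      using nat_approx_posE[of "e / 2"] by auto
    have "1 / real (Suc m) \<le> 1 / real (Suc N)" if "m \<ge> N" for m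
      using that by (simp add: field_simps)
    then have "norm (x m - x n) < e" if "m \<ge> N" "n \<ge> N" for m n
      using le[of m n] N that by (smt (verit) field_sum_of_halves)
    then show "\<exists>N. \<forall>m\<ge>N. \<forall>n\<ge>N. norm (x m - x n) < e"
      by blast
  qed
  then obtain u where u: "x \<longlonglongrightarrow> u"
    by (meson Cauchy_convergent convergent_def)
  have small: "w g = blinfun_apply g u" if "norm g \<le> 1" for g
  proof -
    have "(\<lambda>n. \<bar>w g - blinfun_apply g (x n)\<bar>) \<longlonglongrightarrow> \<bar>w g - blinfun_apply g u\<bar>"
      by (intro tendsto_intros u)
    moreover have "(\<lambda>n. \<bar>w g - blinfun_apply g (x n)\<bar>) \<longlonglongrightarrow> 0"
      by (rule tendsto_sandwich[of "\<lambda>_. 0" _ _ "\<lambda>n. 1 / real (Suc n)"])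
        (use x[OF that] LIMSEQ_inverse_real_of_nat in \<open>auto simp: inverse_eq_divide\<close>)
    ultimately show ?thesis
      using LIMSEQ_unique by fastforce
  qed
  have "w g = blinfun_apply g u" for g
  proof (cases "g = 0")
    case False
    then have "w (inverse (norm g) *\<^sub>R g) = blinfun_apply (inverse (norm g) *\<^sub>R g) u"
      by (intro small) simp
    with False show ?thesis
      by (simp add: w.scaleR blinfun.scaleR_left)
  qed (simp add: w.zero)
  then show ?thesis
    by blast
qed

text \<open>If \<open>w < d\<close> on the unit ball of the annihilator \<open>M\<close> of
  \<open>X\<close>, Hahn-Banach extends \<open>w\<close> from \<open>M\<close> to a functional
  \<open>v\<close> of norm at most \<open>d\<close>. Then \<open>w - v\<close> vanishes on
  \<open>M\<close> and is evaluation at some \<open>x\<close> within \<open>d\<close> of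
  \<open>w\<close>, against \<open>far\<close>.\<close>

lemma helly_annihilator:
  fixes w :: "('a::real_normed_vector \<Rightarrow>\<^sub>L real) \<Rightarrow> real"
  assumes "finite X" "linear w" and "d > 0"
    and far: "\<And>x. \<exists>g. norm g \<le> 1 \<and> \<bar>w g - blinfun_apply g x\<bar> > d"
  shows "\<exists>g. norm g \<le> 1 \<and> (\<forall>x\<in>X. blinfun_apply g x = 0) \<and> w g \<ge> d"
proof (rule ccontr)
  assume contra: "\<not> ?thesis"
  interpret w: linear w by fact
  define M where "M = {g :: 'a \<Rightarrow>\<^sub>L real. \<forall>x\<in>X. blinfun_apply g x = 0}"
  have M: "subspace M"
    by (auto simp: M_def subspace_def blinfun.add_left blinfun.scaleR_left)
  have wM: "w g \<le> d * norm g" if "g \<in> M" for g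
  proof (cases "g = 0")
    case False
    define h where "h = inverse (norm g) *\<^sub>R g"
    have "norm h \<le> 1" "h \<in> M"
      using False that M by (auto simp: h_def subspace_scale)
    then have "w h < d"
      using contra by (force simp: M_def)
    then show ?thesis
      using False by (simp add: h_def w.scaleR field_simps)
  qed (simp add: w.zero)
  obtain v where v: "linear v" "\<And>g. v g \<le> d * norm g" "\<And>g. g \<in> M \<Longrightarrow> v g = w g"
    by (rule hahn_banach_extension[of "\<lambda>g. d * norm g" M "\<lambda>g. g" w])
      (use M wM \<open>linear w\<close> \<open>d > 0\<close> in \<open>auto intro: sublinear_mult sublinear_norm linear_ident\<close>)
  have "\<exists>x. \<forall>g. w g - v g = blinfun_apply g x"
    by (rule functional_in_span_evaluations[OF \<open>finite X\<close>])
      (use v \<open>linear w\<close> in \<open>auto simp: M_def intro: linear_compose_sub\<close>)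
  then obtain x where x: "\<And>g. w g - v g = blinfun_apply g x"
    by blast
  obtain g where g: "norm g \<le> 1" "\<bar>w g - blinfun_apply g x\<bar> > d"
    using far by blast
  have "w g - blinfun_apply g x = v g"
    using x[of g] by simp
  moreover have "\<bar>v g\<bar> \<le> d * norm g"
    using v(2)[of g] v(2)[of "- g"] by (auto simp: linear_neg[OF v(1)] abs_le_iff)
  moreover have "d * norm g \<le> d"
    using g(1) \<open>d > 0\<close> by (simp add: mult_left_le)
  ultimately show False
    using g(2) by simp
qed

text \<open>
  Simons' argument: choosing \<open>h k \<in> C k\<close> such that \<open>s n + h n / 2 ^ n\<close> almost minimizes \<open>S\<close> on
  \<open>s n + C n / 2 ^ n\<close>, the series \<open>f = (\<Sum>k. h k / 2 ^ Suc k)\<close> gains a fixed proportion of the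
  remaining weight beyond each of its partial sums \<open>s n\<close>.
\<close>

lemma simons_series:
  fixes S :: "'a::banach \<Rightarrow> real" and C :: "nat \<Rightarrow> 'a set"
  assumes S: "sublinear S" and S_ge: "\<And>f. - B * norm f \<le> S f"
    and "d > 0" and S_C: "\<And>f. f \<in> C 0 \<Longrightarrow> d \<le> S f"
    and nonempty: "\<And>n. C n \<noteq> {}" and antimono: "\<And>n. C (Suc n) \<subseteq> C n"
    and bounded: "\<And>f n. f \<in> C n \<Longrightarrow> norm f \<le> 1"
    and convex: "\<And>n. convex (C n)"
    and series: "\<And>h n. (\<And>k. h k \<in> C (n + k)) \<Longrightarrow> (\<Sum>k. (1/2) ^ Suc k *\<^sub>R h k) \<in> C n"
  shows "\<exists>f s k. \<forall>n. k n \<in> C n \<and> f = s n + (1/2) ^ n *\<^sub>R k n \<and> S f - S (s n) \<ge> (1/2) ^ n * (3/8 * d)"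
proof -
  \<comment> \<open>Relative to the weight \<open>(1/2) ^ n\<close> the error is
    \<open>d/8 * (1/4) ^ n\<close>, small enough to be absorbed in \<open>gap\<close>.\<close>
  define \<epsilon> where "\<epsilon> n = d * (1/8) ^ Suc n" for n
  have \<epsilon>: "\<epsilon> n > 0" for n
    using \<open>d > 0\<close> by (simp add: \<epsilon>_def)
  have almost_min: "\<exists>h\<in>C n. \<forall>h'\<in>C n. S (s + t *\<^sub>R h) \<le> S (s + t *\<^sub>R h') + e" if "e > 0" for n s t e
  proof -
    have bdd: "bdd_below ((\<lambda>h. S (s + t *\<^sub>R h)) ` C n)"
    proof (rule bdd_belowI2)
      fix h assume "h \<in> C n"
      have "norm (s + t *\<^sub>R h) \<le> norm s + \<bar>t\<bar> * norm h"
        by (metis norm_scaleR norm_triangle_ineq)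
      also have "\<dots> \<le> norm s + \<bar>t\<bar> * 1"
        using bounded[OF \<open>h \<in> C n\<close>] by (intro add_left_mono mult_left_mono) auto
      finally have "\<bar>B\<bar> * norm (s + t *\<^sub>R h) \<le> \<bar>B\<bar> * (norm s + \<bar>t\<bar>)"
        by (intro mult_left_mono) auto
      moreover have "- \<bar>B\<bar> * norm (s + t *\<^sub>R h) \<le> - B * norm (s + t *\<^sub>R h)"
        by (intro mult_right_mono) auto
      ultimately show "- (\<bar>B\<bar> * (norm s + \<bar>t\<bar>)) \<le> S (s + t *\<^sub>R h)"
        using S_ge[of "s + t *\<^sub>R h"] by linarith
    qed
    define m where "m = (INF h\<in>C n. S (s + t *\<^sub>R h))"
    have "\<exists>h\<in>C n. S (s + t *\<^sub>R h) < m + e"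
      using cInf_lessD[of "(\<lambda>h. S (s + t *\<^sub>R h)) ` C n" "m + e"] nonempty[of n] that
      by (auto simp: m_def)
    moreover have "m \<le> S (s + t *\<^sub>R h')" if "h' \<in> C n" for h'
      unfolding m_def using bdd that by (rule cINF_lower)
    ultimately show ?thesis
      by (smt (verit))
  qed
  \<comment> \<open>The minimization uses the whole remaining weight \<open>(1/2) ^ n\<close>, but
    the partial sum advances by half of it only; the other half is left for the later terms.\<close>
  define step where "step n s s' \<longleftrightarrow> (\<exists>h\<in>C n. s' = s + (1/2) ^ Suc n *\<^sub>R h \<and>
      (\<forall>h'\<in>C n. S (s + (1/2) ^ n *\<^sub>R h) \<le> S (s + (1/2) ^ n *\<^sub>R h') + \<epsilon> n))" for n s s'
  have "\<exists>s'. step n s s'" for n s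
    using almost_min[OF \<epsilon>, of n s "(1/2) ^ n" n] unfolding step_def by blast
  then have "\<exists>s. \<forall>n. (n = 0 \<longrightarrow> s n = 0) \<and> step n (s n) (s (Suc n))"
    by (intro dependent_nat_choice) auto
  then obtain s h where s0: "s 0 = 0" and h: "\<And>n. h n \<in> C n"
    and s: "\<And>n. s (Suc n) = s n + (1/2) ^ Suc n *\<^sub>R h n"
    and min: "\<And>n h'. h' \<in> C n \<Longrightarrow> S (s n + (1/2) ^ n *\<^sub>R h n) \<le> S (s n + (1/2) ^ n *\<^sub>R h') + \<epsilon> n"
    unfolding step_def by metis
  define r where "r n = S (s n + (1/2) ^ n *\<^sub>R h n)" for n
  have mono: "C (n + k) \<subseteq> C n" for n k
    by (rule lift_Suc_antimono_le[of C]) (use antimono in auto)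

  have s_sum: "s n = (\<Sum>k<n. (1/2) ^ Suc k *\<^sub>R h k)" for n
    by (induction n) (auto simp: s0 s)
  have summable: "summable (\<lambda>k. (1/2::real) ^ Suc k *\<^sub>R h (n + k))" for n
  proof (rule summable_comparison_test')
    show "summable (\<lambda>k. (1/2::real) ^ Suc k)"
      by (simp add: summable_mult)
    show "norm ((1/2::real) ^ Suc k *\<^sub>R h (n + k)) \<le> (1/2) ^ Suc k" for k
      using bounded[OF h, of "n + k"] by (simp add: divide_simps)
  qed
  define f where "f = (\<Sum>k. (1/2::real) ^ Suc k *\<^sub>R h k)"
  define k where "k n = (\<Sum>j. (1/2::real) ^ Suc j *\<^sub>R h (n + j))" for n
  have k: "k n \<in> C n" for n
    unfolding k_def by (rule series) (rule h)
  have f_eq: "f = s n + (1/2) ^ n *\<^sub>R k n" for n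
  proof -
    have "f = s n + (\<Sum>j. (1/2) ^ Suc (j + n) *\<^sub>R h (j + n))"
      unfolding f_def s_sum using suminf_split_initial_segment[OF summable[of 0], of n] by simp
    also have "(\<lambda>j. (1/2::real) ^ Suc (j + n) *\<^sub>R h (j + n)) =
        (\<lambda>j. (1/2) ^ n *\<^sub>R ((1/2) ^ Suc j *\<^sub>R h (n + j)))"
      by (auto simp: power_add add.commute)
    also have "suminf \<dots> = (1/2) ^ n *\<^sub>R k n"
      unfolding k_def by (rule suminf_scaleR_right[OF summable, symmetric])
    finally show ?thesis .
  qed

  \<comment> \<open>The average of \<open>h n\<close> and \<open>h (Suc n)\<close> competes with
    \<open>h n\<close>, and it leads exactly to the point whose value is
    \<open>r (Suc n)\<close>.\<close>
  have r_step: "r n \<le> r (Suc n) + \<epsilon> n" for n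
  proof -
    have "h (Suc n) \<in> C n"
      using h[of "Suc n"] antimono by blast
    then have "(1/2) *\<^sub>R h n + (1/2) *\<^sub>R h (Suc n) \<in> C n"
      by (intro convexD[OF convex h]) auto
    then have "r n \<le> S (s n + (1/2) ^ n *\<^sub>R ((1/2) *\<^sub>R h n + (1/2) *\<^sub>R h (Suc n))) + \<epsilon> n"
      unfolding r_def by (rule min)
    then show ?thesis
      by (simp add: r_def s algebra_simps)
  qed
  \<comment> \<open>\<open>s (Suc n)\<close> is the midpoint of \<open>s n\<close> and the point
    with value \<open>r n\<close>.\<close>
  have S_step: "S (s (Suc n)) \<le> (S (s n) + r n) / 2" for n
  proof -
    have "s (Suc n) = (1/2) *\<^sub>R s n + (1/2) *\<^sub>R (s n + (1/2) ^ n *\<^sub>R h n)"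
      by (simp add: s scaleR_add_right flip: scaleR_add_left)
    then have "S (s (Suc n)) \<le> S ((1/2) *\<^sub>R s n) + S ((1/2) *\<^sub>R (s n + (1/2) ^ n *\<^sub>R h n))"
      using sublinear_add[OF S] by metis
    also have "\<dots> = (S (s n) + r n) / 2"
      by (subst (1 2) sublinear_scaleR[OF S]) (auto simp: r_def)
    finally show ?thesis .
  qed
  \<comment> \<open>Each step halves the gap up to the error \<open>\<epsilon> n\<close>; the decay
    of the \<open>(1/4) ^ n\<close> term pays for the errors and preserves the constant
    \<open>d/2\<close>.\<close>
  have gap: "(1/2) ^ n * (d/2 + d/2 * (1/4) ^ n) \<le> r n - S (s n)" for n
  proof (induction n)
    case 0
    then show ?case
      using S_C[OF h] by (simp add: r_def s0 sublinear_zero[OF S])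
  next
    case (Suc n)
    define x y :: real where "x = (1/2) ^ n" and "y = (1/4) ^ n"
    have "x \<ge> 0" "y \<ge> 0" and \<epsilon>_eq: "\<epsilon> n = d * x * y / 8"
      by (auto simp: x_def y_def \<epsilon>_def simp flip: power_mult_distrib)
    then have "0 \<le> d * x * y"
      using \<open>d > 0\<close> by simp
    moreover have "x * (d/2 + d/2 * y) \<le> r n - S (s n)"
      using Suc by (simp add: x_def y_def)
    ultimately have "x/2 * (d/2 + d/2 * (y/4)) \<le> r (Suc n) - S (s (Suc n))"
      using r_step[of n] S_step[of n] \<epsilon>_eq by (simp add: algebra_simps)
    then show ?case
      by (simp add: x_def y_def)
  qed
  \<comment> \<open>Now \<open>k n\<close> competes with \<open>h n\<close>, whence
    \<open>r n \<le> S f + \<epsilon> n\<close>; the constant is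
    \<open>3/8 = 1/2 - 1/8\<close>.\<close>
  have "S f - S (s n) \<ge> (1/2) ^ n * (3/8 * d)" for n
  proof -
    have "r n \<le> S f + \<epsilon> n"
      unfolding r_def by (subst f_eq[of n], rule min[OF k])
    moreover have "\<epsilon> n \<le> (1/2) ^ n * (d/8)"
      using \<open>d > 0\<close> by (auto simp: \<epsilon>_def intro!: power_mono)
    moreover have "(1/2) ^ n * (d/2) \<le> (1/2) ^ n * (d/2 + d/2 * (1/4) ^ n)"
      using \<open>d > 0\<close> by (intro mult_left_mono) auto
    ultimately show ?thesis
      using gap[of n] by (simp add: algebra_simps)
  qed
  with k f_eq show ?thesis
    by blast
qed

text \<open>By the finite intersection property the closed sets that contain a tail of the sequence
  meet in \<open>K\<close>. This replaces convergent subsequences, which compactness does not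
  provide in a general topology.\<close>

lemma compactin_cluster_point:
  assumes "compactin T K" and x: "\<And>n::nat. x n \<in> K"
  shows "\<exists>u\<in>K. \<forall>C N. closedin T C \<longrightarrow> (\<forall>n\<ge>N. x n \<in> C) \<longrightarrow> u \<in> C"
proof -
  define \<U> where "\<U> = {C. closedin T C \<and> (\<exists>N. \<forall>n\<ge>N. x n \<in> C)}"
  have "K \<inter> \<Inter>F \<noteq> {}" if "finite F" "F \<subseteq> \<U>" for F
  proof -
    have "\<forall>C\<in>F. eventually (\<lambda>n. x n \<in> C) sequentially"
      using that(2) by (auto simp: \<U>_def eventually_sequentially)
    then have "eventually (\<lambda>n. \<forall>C\<in>F. x n \<in> C) sequentially"
      using that(1) by (simp add: eventually_ball_finite)
    then obtain n where "\<forall>C\<in>F. x n \<in> C"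
      by (auto simp: eventually_sequentially)
    then show ?thesis
      using x[of n] by blast
  qed
  moreover have "\<forall>C\<in>\<U>. closedin T C"
    by (simp add: \<U>_def)
  ultimately have "K \<inter> \<Inter>\<U> \<noteq> {}"
    using assms(1) by (simp add: compactin_fip)
  then show ?thesis
    by (fastforce simp: \<U>_def)
qed

text \<open>Preimages of balls around the values at points of \<open>K\<close> cover
  \<open>K\<close>. The net serves all members of \<open>F\<close> at once.\<close>

lemma continuous_map_finite_net:
  fixes f :: "'i \<Rightarrow> 'a \<Rightarrow> 'b::metric_space"
  assumes "compactin T K" "finite F" and cont: "\<And>i. i \<in> F \<Longrightarrow> continuous_map T euclidean (f i)"
    and "e > 0"
  shows "\<exists>X. finite X \<and> X \<subseteq> K \<and> (\<forall>y\<in>K. \<exists>x\<in>X. \<forall>i\<in>F. dist (f i x) (f i y) < e)"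
proof -
  \<comment> \<open>The factor \<open>topspace T\<close> keeps \<open>U x\<close> inside the carrier
    when \<open>F\<close> is empty.\<close>
  define U where "U x = topspace T \<inter> (\<Inter>i\<in>F. {y \<in> topspace T. f i y \<in> ball (f i x) e})" for x
  have "openin T (U x)" for x
    unfolding U_def
  proof (cases "F = {}")
    case False
    have "openin T {y \<in> topspace T. f i y \<in> ball (f i x) e}" if "i \<in> F" for i
      using cont[OF that] by (rule openin_continuous_map_preimage) auto
    then show "openin T (topspace T \<inter> (\<Inter>i\<in>F. {y \<in> topspace T. f i y \<in> ball (f i x) e}))"
      using False assms(2) by (intro openin_Int openin_INT2) auto
  qed auto
  moreover have "K \<subseteq> \<Union>(U ` K)"
    using compactin_subset_topspace[OF assms(1)] \<open>e > 0\<close> by (auto simp: U_def)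
  ultimately obtain \<F> where "finite \<F>" "\<F> \<subseteq> U ` K" "K \<subseteq> \<Union>\<F>"
    using compactinD[OF assms(1), of "U ` K"] by auto
  then obtain X where "X \<subseteq> K" "finite X" "K \<subseteq> \<Union>(U ` X)"
    using finite_subset_image[of \<F> U K] by auto
  then show ?thesis
    by (intro exI[of _ X]) (fastforce simp: U_def)
qed

text \<open>
  The \<open>x n \<in> Y n\<close> that approximate \<open>y\<close> have a weak cluster point \<open>u\<close> with \<open>g n u = g n y\<close> for all \<open>n\<close>.
  A functional below the upper limit of the \<open>g n\<close> that attains it at \<open>y\<close> vanishes at every \<open>x n\<close>, hence
  at \<open>u\<close>, and cannot distinguish \<open>u\<close> from \<open>y\<close>.
\<close>

lemma eventually_small_if_vanishing_on_nets:
  fixes g :: "nat \<Rightarrow> 'a::real_normed_vector \<Rightarrow>\<^sub>L real"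
  assumes K: "compactin T K"
    and cont: "\<And>f :: 'a \<Rightarrow>\<^sub>L real. continuous_map T euclidean (blinfun_apply f)"
    and g: "\<And>n. norm (g n) \<le> 1" and Y: "\<And>n. Y n \<subseteq> K"
    and net: "\<And>n y. y \<in> K \<Longrightarrow> \<exists>x\<in>Y n. \<forall>i\<le>n. \<bar>g i x - g i y\<bar> < 1 / real (Suc n)"
    and vanish: "\<And>n m x. n < m \<Longrightarrow> x \<in> Y n \<Longrightarrow> g m x = 0"
    and "y \<in> K" "e > 0"
  shows "\<exists>N. \<forall>n\<ge>N. g n y < e"
proof (rule ccontr)
  assume frequently: "\<not> (\<exists>N. \<forall>n\<ge>N. g n y < e)"
  \<comment> \<open>This is the upper limit of \<open>g n x\<close>, bounded by
    \<open>norm x\<close>.\<close>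
  define p where "p x = (INF n. SUP m\<in>{n..}. g m x)" for x
  have abs: "\<bar>g m x\<bar> \<le> norm x" for m x
    using norm_blinfun[of "g m" x] mult_right_mono[OF g, of "norm x" m] by simp
  then have abs': "g m x \<le> norm x" "- norm x \<le> g m x" for m x
    by (simp_all add: abs_le_iff minus_le_iff)
  have bdd: "bdd_above ((\<lambda>m. g m x) ` {n..})" for n x
    using abs' by (intro bdd_aboveI2)
  have sup_ge: "- norm x \<le> (SUP m\<in>{n..}. g m x)" for n x
    by (rule cSUP_upper2[OF bdd, of n]) (auto simp: abs')
  have bdd': "bdd_below (range (\<lambda>n. SUP m\<in>{n..}. g m x))" for x
    using sup_ge by (intro bdd_belowI2)
  have p_le: "p x \<le> c" if "\<And>m. m \<ge> n \<Longrightarrow> g m x \<le> c" for n x c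
    unfolding p_def by (rule cINF_lower2[OF bdd', of n]) (auto intro: cSUP_least that)
  have "sublinear p"
    unfolding p_def
  proof (rule sublinear_INF)
    show "\<exists>k\<in>UNIV. (SUP m\<in>{k..}. g m (x + z)) \<le> (SUP m\<in>{i..}. g m x) + (SUP m\<in>{j..}. g m z)"
      for i j x z
      by (intro bexI[of _ "max i j"] cSUP_least)
        (auto simp: blinfun.add_right intro!: add_mono cSUP_upper bdd)
    show "\<exists>k\<in>UNIV. (SUP m\<in>{k..}. g m (t *\<^sub>R x)) \<le> t * (SUP m\<in>{i..}. g m x)"
      if "t > 0" for i t x
      using that by (intro bexI[of _ i] cSUP_least)
        (auto simp: blinfun.scaleR_right intro!: mult_left_mono cSUP_upper bdd)
  qed (use bdd' in auto)
  have "e \<le> p y"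
    unfolding p_def
  proof (rule cINF_greatest)
    fix n
    obtain m where "m \<ge> n" "e \<le> g m y"
      using frequently by (force simp: not_less)
    then show "e \<le> (SUP m\<in>{n..}. g m y)"
      by (intro cSUP_upper2[OF bdd, of m]) auto
  qed simp
  obtain f0 where f0: "linear f0" "\<And>x. f0 x \<le> p x" "f0 y = p y"
    using hahn_banach_point[OF \<open>sublinear p\<close>, of y] by metis
  have "f0 x \<le> 1 * norm x" for x
    using f0(2)[of x] p_le[of 0 x "norm x"] abs' by (auto intro: order_trans)
  then obtain f :: "'a \<Rightarrow>\<^sub>L real" where f: "\<And>x. f x = f0 x"
    using linear_le_norm_imp_blinfun[OF f0(1), of 1] by blast
  have f_le: "f x \<le> c" if "\<And>m. m \<ge> n \<Longrightarrow> g m x \<le> c" for n x c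
    using f0(2)[of x] p_le[of n x c] that by (simp add: f)
  \<comment> \<open>Applied to \<open>x\<close> and \<open>- x\<close>, domination by the upper
    limit forces \<open>f\<close> to vanish where the \<open>g m\<close> eventually vanish.\<close>
  have f_0: "f x = 0" if "\<And>m. m \<ge> n \<Longrightarrow> g m x = 0" for n x
    using f_le[of n x 0] f_le[of n "- x" 0] that by (force simp: blinfun.minus_right)
  obtain x where x: "\<And>n. x n \<in> Y n" "\<And>n i. i \<le> n \<Longrightarrow> \<bar>g i (x n) - g i y\<bar> < 1 / real (Suc n)"
    using net[OF \<open>y \<in> K\<close>] by metis
  have "x n \<in> K" for n
    using x(1) Y by blast
  then obtain u where u: "\<And>C N. closedin T C \<Longrightarrow> \<forall>n\<ge>N. x n \<in> C \<Longrightarrow> u \<in> C"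
    using compactin_cluster_point[OF K, of x] by metis
  \<comment> \<open>Bounds on a functional that hold along a tail of \<open>x\<close> define closed
    sets of \<open>T\<close>, so \<open>u\<close> inherits them.\<close>
  have close: "\<bar>h u - a\<bar> \<le> d" if "\<And>n. n \<ge> N \<Longrightarrow> \<bar>h (x n) - a\<bar> \<le> d"
    for h :: "'a \<Rightarrow>\<^sub>L real" and N a d
  proof -
    have "closedin T {z \<in> topspace T. h z \<in> cball a d}"
      using cont by (rule closedin_continuous_map_preimage) auto
    moreover have "x n \<in> topspace T" for n
      using \<open>x n \<in> K\<close> compactin_subset_topspace[OF K] by blast
    ultimately have "u \<in> {z \<in> topspace T. h z \<in> cball a d}"
      using that by (intro u[of _ N]) (auto simp: dist_real_def abs_minus_commute)
    then show ?thesis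
      by (auto simp: dist_real_def abs_minus_commute)
  qed
  have "f (x n) = 0" for n
    using vanish[OF _ x(1)] by (intro f_0[of "Suc n"]) auto
  then have "f u = 0"
    using close[of 0 f 0 0] by simp
  moreover have "g i u = g i y" for i
  proof -
    have "\<bar>g i u - g i y\<bar> \<le> d" if "d > 0" for d
    proof -
      obtain N where N: "1 / real (Suc N) < d"
        using nat_approx_posE[OF \<open>d > 0\<close>] by blast
      show ?thesis
      proof (rule close[of "max i N"])
        fix n assume n: "n \<ge> max i N"
        have "1 / real (Suc n) \<le> 1 / real (Suc N)"
          using n by (simp add: field_simps)
        then show "\<bar>g i (x n) - g i y\<bar> \<le> d"
          using x(2)[of i n] n N by simp
      qed
    qed
    then have "\<bar>g i u - g i y\<bar> \<le> 0"
      by (rule field_le_epsilon) simp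
    then show ?thesis
      by simp
  qed
  then have "f (u - y) = 0"
    by (intro f_0[of 0]) (simp add: blinfun.diff_right)
  ultimately show False
    using \<open>e \<le> p y\<close> \<open>e > 0\<close> f f0(3) by (simp add: blinfun.diff_right)
qed

text \<open>By Hahn-Banach separation, \<open>w_le\<close> expresses that \<open>w\<close> lies in
  the weak-star closed convex hull of \<open>K\<close> in the bidual; the claim is that this hull
  consists of vectors of the space.\<close>

theorem krein:
  fixes w :: "('a::banach \<Rightarrow>\<^sub>L real) \<Rightarrow> real"
  assumes K: "compactin T K"
    and cont: "\<And>f :: 'a \<Rightarrow>\<^sub>L real. continuous_map T euclidean (blinfun_apply f)"
    and w: "linear w"
    and w_le: "\<And>f c. (\<And>x. x \<in> K \<Longrightarrow> blinfun_apply f x \<le> c) \<Longrightarrow> w f \<le> c"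
  shows "\<exists>u. \<forall>f. w f = blinfun_apply f u"
proof (rule ccontr)
  assume contra: "\<not> ?thesis"
  interpret w: linear w by fact
  have "\<not> (\<forall>d>0. \<exists>x. \<forall>g. norm g \<le> 1 \<longrightarrow> \<bar>w g - blinfun_apply g x\<bar> \<le> d)"
    using evaluation_if_approximable[OF _ w] contra by blast
  then obtain d where "d > 0" and far: "\<And>x. \<exists>g. norm g \<le> 1 \<and> \<bar>w g - blinfun_apply g x\<bar> > d"
    by (auto simp: not_le)
  have compact: "compact (blinfun_apply f ` K)" for f :: "'a \<Rightarrow>\<^sub>L real"
    using image_compactin[OF K cont[of f]] by simp
  have "bounded K"
    using compact_imp_bounded[OF compact] by (rule weakly_bounded_imp_bounded)
  then obtain B where B: "\<And>x. x \<in> K \<Longrightarrow> norm x \<le> B"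
    by (auto simp: bounded_iff)
  \<comment> \<open>For empty \<open>K\<close> the condition \<open>w_le\<close> would give
    \<open>w 0 \<le> - 1\<close>.\<close>
  have "K \<noteq> {}"
    using w_le[of 0 "- 1"] w.zero by force
  have abs_le: "\<bar>blinfun_apply f x\<bar> \<le> B * norm f" if "x \<in> K" for f x
    using norm_blinfun[of f x] mult_left_mono[OF B[OF that], of "norm f"]
    by (simp add: mult.commute)
  have w_bound: "norm (w f) \<le> norm f * B" for f
  proof -
    have "w f \<le> B * norm f" for f
      using abs_le[of _ f] by (intro w_le) (simp add: abs_le_iff)
    from this[of f] this[of "- f"] show ?thesis
      by (simp add: w.neg abs_le_iff mult.commute)
  qed
  have w_bl: "bounded_linear w"
    by (rule bounded_linear_intro[of w B]) (use w_bound in \<open>simp_all add: w.add w.scaleR\<close>)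

  \<comment> \<open>A stage holds the functionals \<open>F\<close> chosen so far, a finite net
    \<open>Y\<close> of \<open>K\<close> for them with mesh \<open>1 / (n + 1)\<close>, and the
    newest functional \<open>g\<close>. By \<open>succ\<close> the next functional vanishes on the
    current net.\<close>
  define good where "good n = (\<lambda>(F, Y, g). finite F \<and> finite Y \<and> Y \<subseteq> K \<and> g \<in> F \<and> norm g \<le> 1 \<and> d \<le> w g \<and>
    (\<forall>y\<in>K. \<exists>x\<in>Y. \<forall>f\<in>F. \<bar>blinfun_apply f x - blinfun_apply f y\<bar> < 1 / real (Suc n)))" for n
  define succ where "succ n = (\<lambda>(F :: ('a \<Rightarrow>\<^sub>L real) set, Y, g :: 'a \<Rightarrow>\<^sub>L real) (F', Y', g' :: 'a \<Rightarrow>\<^sub>L real). F \<subseteq> F' \<and> Y \<subseteq> Y' \<and>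
    (\<forall>x\<in>Y. blinfun_apply g' x = 0))" for n :: nat
  have extend: "\<exists>s'. good n s' \<and> succ m (F, Y, g) s'"
    if "finite F" "finite Y" "Y \<subseteq> K" for F and Y and g :: "'a \<Rightarrow>\<^sub>L real" and n m
  proof -
    obtain g' where g': "norm g' \<le> 1" "\<forall>x\<in>Y. blinfun_apply g' x = 0" "d \<le> w g'"
      using helly_annihilator[OF \<open>finite Y\<close> w \<open>d > 0\<close> far] by (elim exE conjE)
    obtain X where X: "finite X" "X \<subseteq> K"
      "\<forall>y\<in>K. \<exists>x\<in>X. \<forall>f\<in>insert g' F. dist (blinfun_apply f x) (blinfun_apply f y) < 1 / real (Suc n)"
    proof -
      have "\<exists>X. finite X \<and> X \<subseteq> K \<and> (\<forall>y\<in>K. \<exists>x\<in>X. \<forall>f\<in>insert g' F.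
          dist (blinfun_apply f x) (blinfun_apply f y) < 1 / real (Suc n))"
        by (rule continuous_map_finite_net[OF K _ cont]) (use \<open>finite F\<close> in auto)
      then show ?thesis
        using that by (elim exE conjE)
    qed
    have "good n (insert g' F, X \<union> Y, g')"
      using that g' X by (simp add: good_def dist_real_def) (meson UnI1)
    moreover have "succ m (F, Y, g) (insert g' F, X \<union> Y, g')"
      using g' by (auto simp: succ_def)
    ultimately show ?thesis
      by (intro exI conjI)
  qed
  have "\<exists>s. \<forall>n. good n (s n) \<and> succ n (s n) (s (Suc n))"
  proof (rule dependent_nat_choice)
    show "\<exists>s. good 0 s"
      using extend[of "{}" "{}" 0 0 0] by blast
    show "\<exists>s'. good (Suc n) s' \<and> succ n s s'" if "good n s" for n s
    proof -
      obtain F Y g where s: "s = (F, Y, g)"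
        by (cases s)
      show ?thesis
        unfolding s by (rule extend) (use that in \<open>simp_all add: s good_def\<close>)
    qed
  qed
  then obtain s where s: "\<And>n. good n (s n)" "\<And>n. succ n (s n) (s (Suc n))"
    by blast
  define F where "F n = fst (s n)" for n
  define Y where "Y n = fst (snd (s n))" for n
  define g where "g n = snd (snd (s n))" for n
  have good: "good n (F n, Y n, g n)" and succ: "succ n (F n, Y n, g n) (F (Suc n), Y (Suc n), g (Suc n))"
    for n
    using s[of n] by (simp_all add: F_def Y_def g_def)
  have F_mono: "F m \<subseteq> F n" if "m \<le> n" for m n
    by (rule lift_Suc_mono_le[OF _ that]) (use succ in \<open>simp add: succ_def\<close>)
  have Y_mono: "Y m \<subseteq> Y n" if "m \<le> n" for m n
    by (rule lift_Suc_mono_le[OF _ that]) (use succ in \<open>simp add: succ_def\<close>)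
  have g: "norm (g n) \<le> 1" "d \<le> w (g n)" and Y: "Y n \<subseteq> K" for n
    using good[of n] by (auto simp: good_def)
  have g_in: "g i \<in> F n" if "i \<le> n" for i n
    using good[of i] F_mono[OF that] by (auto simp: good_def)
  have pointwise: "\<exists>N. \<forall>n\<ge>N. g n y < e" if "y \<in> K" "e > 0" for y e
  proof (rule eventually_small_if_vanishing_on_nets[OF K cont g(1) Y _ _ that])
    show "\<exists>x\<in>Y n. \<forall>i\<le>n. \<bar>g i x - g i y\<bar> < 1 / real (Suc n)" if "y \<in> K" for n y
      using good[of n] that g_in[of _ n] by (fastforce simp: good_def)
    show "g m x = 0" if "n < m" "x \<in> Y n" for n m x
    proof -
      obtain l where "m = Suc l"
        using \<open>n < m\<close> by (cases m) auto
      then show ?thesis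
        using succ[of l] Y_mono[of n l] that by (auto simp: succ_def)
    qed
  qed

  define S where "S f = (SUP x\<in>K. blinfun_apply f x)" for f :: "'a \<Rightarrow>\<^sub>L real"
  have bdd: "bdd_above (blinfun_apply f ` K)" for f :: "'a \<Rightarrow>\<^sub>L real"
    using compact by (intro bounded_imp_bdd_above compact_imp_bounded)
  have S_upper: "blinfun_apply f x \<le> S f" if "x \<in> K" for f x
    unfolding S_def by (rule cSUP_upper[OF that bdd])
  have S_least: "S f \<le> c" if "\<And>x. x \<in> K \<Longrightarrow> blinfun_apply f x \<le> c" for f c
    unfolding S_def by (rule cSUP_least[OF \<open>K \<noteq> {}\<close> that])
  have w_le_S: "w f \<le> S f" for f
    by (rule w_le) (rule S_upper)
  have "S (f + h) \<le> S f + S h" for f h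
    by (rule S_least) (simp add: blinfun.add_left add_mono S_upper)
  moreover have "S (t *\<^sub>R f) \<le> t * S f" if "t > 0" for t f
    by (rule S_least) (use that in \<open>simp add: blinfun.scaleR_left S_upper\<close>)
  ultimately have "sublinear S"
    by (simp add: sublinear_def)
  \<comment> \<open>On \<open>K\<close>, \<open>h\<close> lies below the supremum of the
    \<open>g j\<close> with \<open>j \<ge> n\<close>. Unlike the convex hull of these
    \<open>g j\<close>, a set described by such inequalities is visibly closed under infinite convex
    combinations.\<close>
  define C where "C n = {h. norm h \<le> 1 \<and> d \<le> w h \<and>
    (\<forall>y\<in>K. \<forall>c. (\<forall>j\<ge>n. g j y \<le> c) \<longrightarrow> blinfun_apply h y \<le> c)}" for n
  have "\<exists>f s k. \<forall>n. k n \<in> C n \<and> f = s n + (1/2) ^ n *\<^sub>R k n \<and> S f - S (s n) \<ge> (1/2) ^ n * (3/8 * d)"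
  proof (rule simons_series[where B = B])
    show "- B * norm f \<le> S f" for f
      using w_bound[of f] w_le_S[of f] by (simp add: abs_le_iff mult.commute)
    show "C n \<noteq> {}" for n
      using g by (auto simp: C_def)
    show "C (Suc n) \<subseteq> C n" for n
      by (auto simp: C_def)
    show "convex (C n)" for n
      unfolding convex_def
    proof (intro ballI allI impI)
      fix f h and a b :: real
      assume f: "f \<in> C n" and h: "h \<in> C n" and ab: "0 \<le> a" "0 \<le> b" "a + b = 1"
      have "norm (a *\<^sub>R f + b *\<^sub>R h) \<le> a * norm f + b * norm h"
        using ab norm_triangle_ineq[of "a *\<^sub>R f" "b *\<^sub>R h"] by simp
      also have "\<dots> \<le> 1"
        using f h ab by (intro convex_bound_le) (auto simp: C_def)
      finally have "norm (a *\<^sub>R f + b *\<^sub>R h) \<le> 1" .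
      moreover have "- (a * w f + b * w h) \<le> - d"
        using f h ab convex_bound_le[of "- w f" "- d" "- w h" a b] by (auto simp: C_def)
      moreover have "a * f y + b * h y \<le> c" if "y \<in> K" "\<forall>j\<ge>n. g j y \<le> c" for y c
        using f h ab that by (intro convex_bound_le) (auto simp: C_def)
      ultimately show "a *\<^sub>R f + b *\<^sub>R h \<in> C n"
        by (auto simp: C_def w.add w.scaleR blinfun.add_left blinfun.scaleR_left)
    qed
    show "(\<Sum>k. (1/2) ^ Suc k *\<^sub>R h k) \<in> C n" if h: "\<And>k. h k \<in> C (n + k)" for h n
    proof -
      have half: "(\<lambda>k. (1/2::real) ^ Suc k * c) sums c" for c
        using sums_mult2[OF power_half_series, of c] by simp
      have le: "norm ((1/2::real) ^ Suc k *\<^sub>R h k) \<le> (1/2) ^ Suc k * 1" for k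
        using h[of k] by (simp add: C_def divide_simps)
      have summable: "summable (\<lambda>k. norm ((1/2::real) ^ Suc k *\<^sub>R h k))"
        by (rule summable_comparison_test'[OF sums_summable[OF half[of 1]]]) (use le in auto)
      have sums: "(\<lambda>k. (1/2::real) ^ Suc k *\<^sub>R h k) sums (\<Sum>k. (1/2) ^ Suc k *\<^sub>R h k)"
        using summable_norm_cancel[OF summable] by (rule summable_sums)
      have "norm (\<Sum>k. (1/2::real) ^ Suc k *\<^sub>R h k) \<le> (\<Sum>k. norm ((1/2::real) ^ Suc k *\<^sub>R h k))"
        by (rule summable_norm[OF summable])
      also have "\<dots> \<le> 1"
        by (rule sums_le[OF le summable_sums[OF summable] half])
      finally have "norm (\<Sum>k. (1/2::real) ^ Suc k *\<^sub>R h k) \<le> 1" .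
      moreover have "d \<le> w (\<Sum>k. (1/2) ^ Suc k *\<^sub>R h k)"
      proof (rule sums_le[OF _ half bounded_linear.sums[OF w_bl sums]])
        show "(1/2) ^ Suc k * d \<le> w ((1/2) ^ Suc k *\<^sub>R h k)" for k
          using h[of k] by (simp add: w.scaleR C_def divide_right_mono)
      qed
      moreover have "blinfun_apply (\<Sum>k. (1/2) ^ Suc k *\<^sub>R h k) y \<le> c"
        if "y \<in> K" "\<forall>j\<ge>n. g j y \<le> c" for y c
      proof (rule sums_le[OF _ bounded_linear.sums[OF blinfun.bounded_linear_left sums] half])
        show "blinfun_apply ((1/2) ^ Suc k *\<^sub>R h k) y \<le> (1/2) ^ Suc k * c" for k
          using h[of k] that by (simp add: blinfun.scaleR_left C_def divide_right_mono)
      qed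
      ultimately show ?thesis
        by (auto simp: C_def)
    qed
  qed (use \<open>sublinear S\<close> \<open>d > 0\<close> w_le_S in \<open>auto simp: C_def intro: order_trans\<close>)
  then obtain f s k where k: "\<And>n. k n \<in> C n" and f: "\<And>n. f = s n + (1/2) ^ n *\<^sub>R k n"
    and gap: "\<And>n. S f - S (s n) \<ge> (1/2) ^ n * (3/8 * d)"
    by metis
  \<comment> \<open>By compactness \<open>f\<close> attains its supremum at some \<open>y\<close>.
    There the gain forces \<open>k N y\<close> to be at least \<open>3/8 * d\<close>, whereas
    pointwise convergence leaves at most \<open>d/4\<close>.\<close>
  have "\<exists>y\<in>K. \<forall>x\<in>K. f x \<le> f y"
    using compact_attains_sup[OF compact, of f] \<open>K \<noteq> {}\<close> by blast
  then obtain y where y: "y \<in> K" "\<And>x. x \<in> K \<Longrightarrow> f x \<le> f y"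
    by blast
  have "S f \<le> f y"
    by (rule S_least) (rule y)
  obtain N where N: "\<forall>n\<ge>N. g n y < d/4"
    using pointwise[OF y(1), of "d/4"] \<open>d > 0\<close> by auto
  have "s N y \<le> S (s N)"
    by (rule S_upper[OF y(1)])
  moreover have "f y = s N y + (1/2) ^ N * k N y"
    by (subst f[of N]) (simp add: blinfun.add_left blinfun.scaleR_left)
  ultimately have "(1/2) ^ N * (3/8 * d) \<le> (1/2) ^ N * k N y"
    using gap[of N] \<open>S f \<le> f y\<close> by linarith
  then have "3/8 * d \<le> k N y"
    by simp
  moreover have "k N y \<le> d/4"
  proof -
    have "\<forall>j\<ge>N. g j y \<le> d/4"
      using N by (simp add: less_imp_le)
    with k[of N] y(1) show ?thesis
      unfolding C_def by blast
  qed
  ultimately show False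
    using \<open>d > 0\<close> by simp
qed

section \<open>Means of commuting operators\<close>

lemma blinfun_compose_assoc: "(f o\<^sub>L g) o\<^sub>L h = f o\<^sub>L (g o\<^sub>L h)"
  by (rule blinfun_eqI) simp

text \<open>This isolates what is used of the convex hull of a commuting, uniformly bounded group of
  operators.\<close>

locale operator_means =
  fixes A :: "('v::banach \<Rightarrow>\<^sub>L 'v) set" and M :: real
  assumes convex: "convex A" and id_mem: "id_blinfun \<in> A"
    and compose_mem: "\<And>a b. a \<in> A \<Longrightarrow> b \<in> A \<Longrightarrow> a o\<^sub>L b \<in> A"
    and commute: "\<And>a b. a \<in> A \<Longrightarrow> b \<in> A \<Longrightarrow> a o\<^sub>L b = b o\<^sub>L a"
    and norm_le: "\<And>a. a \<in> A \<Longrightarrow> norm a \<le> M" and M_pos: "M > 0"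
begin

lemma norm_apply_le: "a \<in> A \<Longrightarrow> norm (blinfun_apply a x) \<le> M * norm x"
  using norm_blinfun[of a x] mult_right_mono[OF norm_le, of a "norm x"] by simp

text \<open>Here \<open>a\<close> is the Cesaro mean of \<open>id, s, ..., s^n\<close> and
  \<open>c\<close> is \<open>s^(n+1)\<close>, so the sum telescopes. The induction records
  membership in \<open>A\<close> only and avoids powers of \<open>s\<close>.\<close>

lemma cesaro_mean:
  assumes "s \<in> A"
  shows "\<exists>a\<in>A. \<exists>c\<in>A. real (Suc n) *\<^sub>R (a o\<^sub>L (s - id_blinfun)) = c - id_blinfun"
proof (induction n)
  case 0
  then show ?case
    using assms id_mem by (intro bexI[of _ id_blinfun] bexI[of _ s]) (auto intro: blinfun_eqI)
next
  case (Suc n)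
  then obtain a c where a: "a \<in> A" "c \<in> A" "real (Suc n) *\<^sub>R (a o\<^sub>L (s - id_blinfun)) = c - id_blinfun"
    by blast
  define N where "N = real (Suc n)"
  define b where "b = (N / (N + 1)) *\<^sub>R a + (1 / (N + 1)) *\<^sub>R c"
  have "N + 1 > 0"
    by (simp add: N_def)
  then have "b \<in> A"
    unfolding b_def using a(1,2) by (intro convexD[OF convex]) (auto simp: N_def divide_simps)
  moreover have "(N + 1) *\<^sub>R (b o\<^sub>L (s - id_blinfun)) = (c o\<^sub>L s) - id_blinfun"
  proof (rule blinfun_eqI)
    fix x
    have "N *\<^sub>R blinfun_apply a (blinfun_apply s x - x) = blinfun_apply c x - x"
      using arg_cong[OF a(3), of "\<lambda>f. blinfun_apply f x"]
      by (simp add: N_def blinfun.scaleR_left blinfun.diff_left)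
    moreover have "(N + 1) *\<^sub>R blinfun_apply b y = N *\<^sub>R blinfun_apply a y + blinfun_apply c y" for y
      using \<open>N + 1 > 0\<close> by (simp add: b_def blinfun.add_left blinfun.scaleR_left scaleR_add_right)
    ultimately have "(N + 1) *\<^sub>R blinfun_apply b (blinfun_apply s x - x) = blinfun_apply c (blinfun_apply s x) - x"
      by (simp add: blinfun.diff_right[of c])
    then show "blinfun_apply ((N + 1) *\<^sub>R (b o\<^sub>L (s - id_blinfun))) x =
        blinfun_apply ((c o\<^sub>L s) - id_blinfun) x"
      by (simp add: blinfun.scaleR_left blinfun.diff_left)
  qed
  moreover have "c o\<^sub>L s \<in> A"
    using a(2) assms by (rule compose_mem)
  moreover have "N + 1 = real (Suc (Suc n))"
    by (simp add: N_def)
  ultimately show ?case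
    by metis
qed

text \<open>The mean is \<open>p x = inf_a sup_b \<phi> x (b a)\<close>. Its last property is a form
  of invariance: composition with a Cesaro mean makes \<open>s - 1\<close> of order
  \<open>1 / n\<close>.\<close>

lemma sublinear_upper_mean:
  fixes \<phi> :: "'x::real_vector \<Rightarrow> ('v \<Rightarrow>\<^sub>L 'v) \<Rightarrow> real"
  assumes sub: "\<And>c. c \<in> A \<Longrightarrow> sublinear (\<lambda>x. \<phi> x c)"
    and bound: "\<And>x. \<exists>B. \<forall>c\<in>A. \<bar>\<phi> x c\<bar> \<le> B"
  shows "\<exists>p. sublinear p \<and>
    (\<forall>x B. (\<forall>c\<in>A. \<phi> x c \<le> B) \<longrightarrow> p x \<le> B) \<and> (\<forall>x B. (\<forall>c\<in>A. B \<le> \<phi> x c) \<longrightarrow> B \<le> p x) \<and>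
    (\<forall>x B. \<forall>s\<in>A. (\<forall>c\<in>A. \<phi> x c \<le> B * norm (c o\<^sub>L (s - id_blinfun))) \<longrightarrow> p x \<le> 0)"
proof -
  define F where "F a x = (SUP b\<in>A. \<phi> x (b o\<^sub>L a))" for a x
  have bdd: "bdd_above ((\<lambda>b. \<phi> x (b o\<^sub>L a)) ` A)" if "a \<in> A" for a x
  proof -
    obtain B where "\<forall>c\<in>A. \<bar>\<phi> x c\<bar> \<le> B"
      using bound by blast
    then show ?thesis
      using compose_mem[OF _ that] by (intro bdd_aboveI2[where M = B]) (force simp: abs_le_iff)
  qed
  have upper: "\<phi> x (b o\<^sub>L a) \<le> F a x" if "a \<in> A" "b \<in> A" for a b x
    unfolding F_def by (rule cSUP_upper[OF that(2) bdd[OF that(1)]])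
  have least: "F a x \<le> B" if "\<And>b. b \<in> A \<Longrightarrow> \<phi> x (b o\<^sub>L a) \<le> B" for a x B
    unfolding F_def by (rule cSUP_least) (use id_mem that in auto)
  have ge: "B \<le> F a x" if "a \<in> A" "\<forall>c\<in>A. B \<le> \<phi> x c" for a x B
    using upper[OF that(1) id_mem, of x] compose_mem[OF id_mem that(1)] that(2) by (meson order_trans)
  have bdd': "bdd_below ((\<lambda>a. F a x) ` A)" for x
  proof -
    obtain B where "\<forall>c\<in>A. \<bar>\<phi> x c\<bar> \<le> B"
      using bound by blast
    then have "\<forall>c\<in>A. - B \<le> \<phi> x c"
      by (force simp: abs_le_iff)
    then show ?thesis
      using ge by (intro bdd_belowI2)
  qed
  define p where "p x = (INF a\<in>A. F a x)" for x
  have p_le: "p x \<le> F a x" if "a \<in> A" for a x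
    unfolding p_def by (rule cINF_lower[OF bdd' that])
  have "sublinear p"
    unfolding p_def
  proof (rule sublinear_INF)
    fix a c x y assume ac: "a \<in> A" "c \<in> A"
    \<comment> \<open>Commutativity writes \<open>b a c\<close> both as \<open>(b c) a\<close> and
      as \<open>(b a) c\<close>, so each of the two suprema dominates its term.\<close>
    have "F (a o\<^sub>L c) (x + y) \<le> F a x + F c y"
    proof (rule least)
      fix b assume b: "b \<in> A"
      have "\<phi> (x + y) (b o\<^sub>L (a o\<^sub>L c)) \<le> \<phi> x (b o\<^sub>L (a o\<^sub>L c)) + \<phi> y (b o\<^sub>L (a o\<^sub>L c))"
        using ac b by (intro sublinear_add sub compose_mem)
      moreover have "b o\<^sub>L (a o\<^sub>L c) = (b o\<^sub>L c) o\<^sub>L a" "b o\<^sub>L (a o\<^sub>L c) = (b o\<^sub>L a) o\<^sub>L c"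
        using commute[OF ac] by (simp_all add: blinfun_compose_assoc)
      moreover have "\<phi> x ((b o\<^sub>L c) o\<^sub>L a) \<le> F a x" "\<phi> y ((b o\<^sub>L a) o\<^sub>L c) \<le> F c y"
        using ac b by (auto intro!: upper compose_mem)
      ultimately show "\<phi> (x + y) (b o\<^sub>L (a o\<^sub>L c)) \<le> F a x + F c y"
        by simp
    qed
    then show "\<exists>k\<in>A. F k (x + y) \<le> F a x + F c y"
      using compose_mem[OF ac] by blast
  next
    fix a t x assume a: "a \<in> A" and "t > (0::real)"
    have "F a (t *\<^sub>R x) \<le> t * F a x"
    proof (rule least)
      fix b assume b: "b \<in> A"
      have "\<phi> (t *\<^sub>R x) (b o\<^sub>L a) = t * \<phi> x (b o\<^sub>L a)"
        using sublinear_scaleR[OF sub[OF compose_mem[OF b a]] \<open>t > 0\<close>] .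
      then show "\<phi> (t *\<^sub>R x) (b o\<^sub>L a) \<le> t * F a x"
        using upper[OF a b] \<open>t > 0\<close> by simp
    qed
    then show "\<exists>k\<in>A. F k (t *\<^sub>R x) \<le> t * F a x"
      using a by blast
  qed (use id_mem bdd' in auto)
  moreover have "p x \<le> B" if "\<forall>c\<in>A. \<phi> x c \<le> B" for x B
  proof -
    have "F id_blinfun x \<le> B"
      using that compose_mem[OF _ id_mem] by (intro least) blast
    then show ?thesis
      using p_le[OF id_mem, of x] by simp
  qed
  moreover have "B \<le> p x" if "\<forall>c\<in>A. B \<le> \<phi> x c" for x B
    unfolding p_def by (rule cINF_greatest) (use id_mem ge that in auto)
  moreover have "p x \<le> 0" if "s \<in> A" and x: "\<forall>c\<in>A. \<phi> x c \<le> B * norm (c o\<^sub>L (s - id_blinfun))" for x B s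
  proof -
    have "p x \<le> (\<bar>B\<bar> * (2 * M)) * inverse (real (Suc n))" for n
    proof -
      obtain a c where a: "a \<in> A" "c \<in> A"
        "real (Suc n) *\<^sub>R (a o\<^sub>L (s - id_blinfun)) = c - id_blinfun"
        using cesaro_mean[OF \<open>s \<in> A\<close>] by blast
      have a_eq: "a o\<^sub>L (s - id_blinfun) = inverse (real (Suc n)) *\<^sub>R (c - id_blinfun)"
        by (simp flip: a(3))
      have "F a x \<le> (\<bar>B\<bar> * (2 * M)) * inverse (real (Suc n))"
      proof (rule least)
        fix b assume b: "b \<in> A"
        have "(b o\<^sub>L a) o\<^sub>L (s - id_blinfun) = inverse (real (Suc n)) *\<^sub>R ((b o\<^sub>L c) - b)"
          unfolding blinfun_compose_assoc a_eq
          by (rule blinfun_eqI) (simp add: blinfun.scaleR_left blinfun.diff_left blinfun.scaleR_right blinfun.diff_right)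
        then have "norm ((b o\<^sub>L a) o\<^sub>L (s - id_blinfun)) = inverse (real (Suc n)) * norm ((b o\<^sub>L c) - b)"
          by simp
        also have "norm ((b o\<^sub>L c) - b) \<le> 2 * M"
          using norm_triangle_ineq4[of "b o\<^sub>L c" b] norm_le[OF b] norm_le[OF compose_mem[OF b a(2)]]
          by linarith
        finally have "norm ((b o\<^sub>L a) o\<^sub>L (s - id_blinfun)) \<le> 2 * M * inverse (real (Suc n))"
          by (simp add: mult.commute)
        then have "\<bar>B\<bar> * norm ((b o\<^sub>L a) o\<^sub>L (s - id_blinfun)) \<le> \<bar>B\<bar> * (2 * M * inverse (real (Suc n)))"
          by (rule mult_left_mono) simp
        moreover have "B * norm ((b o\<^sub>L a) o\<^sub>L (s - id_blinfun)) \<le> \<bar>B\<bar> * norm ((b o\<^sub>L a) o\<^sub>L (s - id_blinfun))"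
          by (rule mult_right_mono) auto
        moreover have "\<phi> x (b o\<^sub>L a) \<le> B * norm ((b o\<^sub>L a) o\<^sub>L (s - id_blinfun))"
          using x compose_mem[OF b a(1)] by blast
        ultimately show "\<phi> x (b o\<^sub>L a) \<le> (\<bar>B\<bar> * (2 * M)) * inverse (real (Suc n))"
          by (simp only: mult.assoc)
      qed
      then show ?thesis
        using p_le[OF a(1), of x] by simp
    qed
    moreover have "(\<lambda>n. (\<bar>B\<bar> * (2 * M)) * inverse (real (Suc n))) \<longlonglongrightarrow> (\<bar>B\<bar> * (2 * M)) * 0"
      by (intro tendsto_mult tendsto_const LIMSEQ_inverse_real_of_nat)
    ultimately show ?thesis
      by (auto intro: LIMSEQ_le_const)
  qed
  ultimately show ?thesis
    by (intro exI[of _ p]) blast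
qed

text \<open>By \<open>K_le\<close> the vectors \<open>a v\<close> lie in the closed convex hull of
  \<open>K\<close>, so \<open>K\<close> may be an orbit closure, which is rarely convex.\<close>

theorem mean_ergodic:
  assumes cont: "\<And>f :: 'v \<Rightarrow>\<^sub>L real. continuous_map T euclidean (blinfun_apply f)"
    and K: "compactin T K"
    and K_le: "\<And>(f :: 'v \<Rightarrow>\<^sub>L real) c a. (\<And>x. x \<in> K \<Longrightarrow> blinfun_apply f x \<le> c) \<Longrightarrow> a \<in> A \<Longrightarrow>
      blinfun_apply f (blinfun_apply a v) \<le> c"
    and no_fixed: "\<And>u. (\<And>a. a \<in> A \<Longrightarrow> blinfun_apply a u = u) \<Longrightarrow> u = 0"
    and "e > 0"
  shows "\<exists>a\<in>A. norm (blinfun_apply a v) < e"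
proof (rule ccontr)
  assume contra: "\<not> ?thesis"
  define \<phi> where "\<phi> x c = norm (blinfun_apply c x)" for x :: 'v and c :: "'v \<Rightarrow>\<^sub>L 'v"
  have \<phi>: "\<bar>\<phi> x c\<bar> \<le> M * norm x" if "c \<in> A" for x c
    using norm_apply_le[OF that] by (simp add: \<phi>_def)
  have "sublinear (\<lambda>x. \<phi> x c)" for c
    by (auto simp: sublinear_def \<phi>_def blinfun.add_right blinfun.scaleR_right norm_triangle_ineq)
  then obtain p where p: "sublinear p" "\<And>x B. \<forall>c\<in>A. \<phi> x c \<le> B \<Longrightarrow> p x \<le> B"
    "\<And>x B. \<forall>c\<in>A. B \<le> \<phi> x c \<Longrightarrow> B \<le> p x"
    "\<And>x B s. s \<in> A \<Longrightarrow> \<forall>c\<in>A. \<phi> x c \<le> B * norm (c o\<^sub>L (s - id_blinfun)) \<Longrightarrow> p x \<le> 0"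
    using sublinear_upper_mean[of \<phi>] \<phi> by metis
  have pv: "e \<le> p v"
    using contra by (intro p(3)) (auto simp: \<phi>_def not_less)
  obtain f0 where f0: "linear f0" "\<And>x. f0 x \<le> p x" "f0 v = p v"
    using hahn_banach_point[OF p(1), of v] by metis
  have "f0 x \<le> M * norm x" for x
    using f0(2)[of x] p(2)[of x "M * norm x"] \<phi> by (force simp: abs_le_iff)
  then obtain f :: "'v \<Rightarrow>\<^sub>L real" where f: "\<And>x. blinfun_apply f x = f0 x"
    using linear_le_norm_imp_blinfun[OF f0(1)] by blast
  \<comment> \<open>Since \<open>norm (c (s x - x)) \<le> norm x * norm (c (s - 1))\<close>, the
    mean \<open>p\<close> is at most 0 at \<open>s x - x\<close> and at its negative.\<close>
  have f_inv: "blinfun_apply f (blinfun_apply s x) = blinfun_apply f x" if s: "s \<in> A" for s x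
  proof -
    have le: "norm (blinfun_apply c (blinfun_apply s x - x)) \<le> norm x * norm (c o\<^sub>L (s - id_blinfun))"
      for c :: "'v \<Rightarrow>\<^sub>L 'v"
      using norm_blinfun[of "c o\<^sub>L (s - id_blinfun)" x] by (simp add: blinfun.diff_left mult.commute)
    have "p (blinfun_apply s x - x) \<le> 0"
      using le by (intro p(4)[OF s, of _ "norm x"]) (simp add: \<phi>_def)
    moreover have "p (x - blinfun_apply s x) \<le> 0"
      using le by (intro p(4)[OF s, of _ "norm x"])
        (simp add: \<phi>_def blinfun.diff_right norm_minus_commute)
    ultimately show ?thesis
      using f0(2)[of "blinfun_apply s x - x"] f0(2)[of "x - blinfun_apply s x"]
      by (simp add: f linear_diff[OF f0(1)])
  qed

  \<comment> \<open>The second mean runs over the values of a functional at the vectors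
    \<open>c v\<close>; a linear \<open>w\<close> below it is the invariant element of the
    bidual.\<close>
  define \<psi> where "\<psi> g c = blinfun_apply g (blinfun_apply c v)" for g :: "'v \<Rightarrow>\<^sub>L real" and c :: "'v \<Rightarrow>\<^sub>L 'v"
  have \<psi>: "\<bar>\<psi> g c\<bar> \<le> norm g * (M * norm v)" if "c \<in> A" for g c
    using norm_blinfun[of g "blinfun_apply c v"] mult_left_mono[OF norm_apply_le[OF that], of "norm g" v]
    by (simp add: \<psi>_def)
  have "sublinear (\<lambda>g. \<psi> g c)" for c
    by (auto simp: sublinear_def \<psi>_def blinfun.add_left blinfun.scaleR_left)
  then obtain q where q: "sublinear q" "\<And>g B. \<forall>c\<in>A. \<psi> g c \<le> B \<Longrightarrow> q g \<le> B"
    "\<And>g B s. s \<in> A \<Longrightarrow> \<forall>c\<in>A. \<psi> g c \<le> B * norm (c o\<^sub>L (s - id_blinfun)) \<Longrightarrow> q g \<le> 0"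
    using sublinear_upper_mean[of \<psi>] \<psi> by metis
  obtain w where w: "linear w" "\<And>g. w g \<le> q g"
    using hahn_banach_point[OF q(1)] by metis
  have w_le: "w g \<le> B" if "\<And>c. c \<in> A \<Longrightarrow> \<psi> g c \<le> B" for g B
    using w(2)[of g] q(2)[of g B] that by force
  have "\<exists>u. \<forall>g. w g = blinfun_apply g u"
    by (rule krein[OF K cont w(1)]) (auto simp: \<psi>_def intro!: w_le K_le)
  then obtain u where u: "\<And>g. w g = blinfun_apply g u"
    by blast
  have "blinfun_apply s u = u" if s: "s \<in> A" for s
  proof (rule blinfun_separates)
    fix g :: "'v \<Rightarrow>\<^sub>L real"
    \<comment> \<open>Commutativity moves \<open>s\<close> to the right:
      \<open>g (s (c v)) - g (c v) = g (c (s - 1) v)\<close>.\<close>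
    have eq: "\<psi> ((g o\<^sub>L s) - g) c = blinfun_apply g (blinfun_apply (c o\<^sub>L (s - id_blinfun)) v)" if "c \<in> A" for c
    proof -
      have "blinfun_apply (s o\<^sub>L c) v = blinfun_apply (c o\<^sub>L s) v"
        using commute[OF s that] by simp
      then show ?thesis
        by (simp add: \<psi>_def blinfun.diff_left blinfun.diff_right)
    qed
    have le: "\<bar>\<psi> ((g o\<^sub>L s) - g) c\<bar> \<le> norm g * norm v * norm (c o\<^sub>L (s - id_blinfun))" if "c \<in> A" for c
    proof -
      have "\<bar>\<psi> ((g o\<^sub>L s) - g) c\<bar> \<le> norm g * norm (blinfun_apply (c o\<^sub>L (s - id_blinfun)) v)"
        using norm_blinfun[of g] by (simp only: eq[OF that]) (metis real_norm_def)
      also have "\<dots> \<le> norm g * (norm (c o\<^sub>L (s - id_blinfun)) * norm v)"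
        by (intro mult_left_mono norm_blinfun) simp
      finally show ?thesis
        by (simp only: ac_simps)
    qed
    have "w ((g o\<^sub>L s) - g) \<le> 0"
      using w(2)[of "(g o\<^sub>L s) - g"] q(3)[OF s, of "(g o\<^sub>L s) - g" "norm g * norm v"] le
      by (force simp: abs_le_iff)
    moreover have "w (g - (g o\<^sub>L s)) \<le> 0"
    proof -
      have "\<psi> (g - (g o\<^sub>L s)) c = - \<psi> ((g o\<^sub>L s) - g) c" for c
        by (simp add: \<psi>_def blinfun.diff_left)
      then show ?thesis
        using w(2)[of "g - (g o\<^sub>L s)"] q(3)[OF s, of "g - (g o\<^sub>L s)" "norm g * norm v"] le
        by (force simp: abs_le_iff)
    qed
    ultimately show "blinfun_apply g (blinfun_apply s u) = blinfun_apply g u"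
      by (simp add: u blinfun.diff_left)
  qed
  then have "u = 0"
    by (rule no_fixed)
  \<comment> \<open>Invariance makes \<open>f\<close> constant on all \<open>c v\<close>, so
    \<open>f u \<ge> f v \<ge> e\<close>, which contradicts \<open>u = 0\<close>.\<close>
  moreover have "w (- f) \<le> - blinfun_apply f v"
    by (rule w_le) (simp add: \<psi>_def f_inv blinfun.minus_left)
  ultimately show False
    using f0(3) pv \<open>e > 0\<close> by (simp add: u f)
qed

text \<open>Means are composed: the first brings \<open>F\<close> below \<open>e / M\<close>, which
  the second, chosen for the image of \<open>y\<close>, enlarges by a factor of at most
  \<open>M\<close>.\<close>

lemma small_mean_on_finite:
  assumes erg: "\<And>v e. e > 0 \<Longrightarrow> \<exists>a\<in>A. norm (blinfun_apply a v) < e"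
    and "finite F" "e > 0"
  shows "\<exists>a\<in>A. \<forall>v\<in>F. norm (blinfun_apply a v) < e"
  using assms(2,3)
proof (induction F arbitrary: e rule: finite_induct)
  case empty
  then show ?case
    using id_mem by auto
next
  case (insert y F)
  obtain a where a: "a \<in> A" "\<forall>v\<in>F. norm (blinfun_apply a v) < e / M"
    using insert.IH[of "e / M"] insert.prems M_pos by auto
  obtain b where b: "b \<in> A" "norm (blinfun_apply b (blinfun_apply a y)) < e"
    using erg insert.prems by blast
  have "norm (blinfun_apply b (blinfun_apply a v)) < e" if "v \<in> F" for v
  proof -
    have "norm (blinfun_apply b (blinfun_apply a v)) \<le> M * norm (blinfun_apply a v)"
      by (rule norm_apply_le[OF b(1)])
    also have "\<dots> < e"
      using a(2) that M_pos by (simp add: field_simps)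
    finally show ?thesis .
  qed
  then show ?case
    using b compose_mem[OF b(1) a(1)] by (intro bexI[of _ "b o\<^sub>L a"]) auto
qed

text \<open>A finite net of mesh \<open>e / (2 * M)\<close> suffices because all means are bounded
  by \<open>M\<close>.\<close>

lemma small_mean_on_compact:
  assumes "\<And>v e. e > 0 \<Longrightarrow> \<exists>a\<in>A. norm (blinfun_apply a v) < e"
    and "compact C" "e > 0"
  shows "\<exists>a\<in>A. \<forall>v\<in>C. norm (blinfun_apply a v) < e"
proof -
  have "e / (2 * M) > 0"
    using \<open>e > 0\<close> M_pos by simp
  then obtain F where F: "finite F" "C \<subseteq> (\<Union>x\<in>F. ball x (e / (2 * M)))"
    using seq_compact_imp_totally_bounded[OF \<open>compact C\<close>[unfolded compact_eq_seq_compact_metric]]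
    by blast
  obtain a where a: "a \<in> A" "\<forall>v\<in>F. norm (blinfun_apply a v) < e / 2"
    using small_mean_on_finite[OF assms(1) F(1), of "e / 2"] \<open>e > 0\<close> by auto
  have "norm (blinfun_apply a v) < e" if "v \<in> C" for v
  proof -
    obtain x where x: "x \<in> F" "norm (v - x) < e / (2 * M)"
      using F(2) \<open>v \<in> C\<close> by (auto simp: dist_norm norm_minus_commute[of v])
    have "norm (blinfun_apply a v) \<le> norm (blinfun_apply a x) + norm (blinfun_apply a (v - x))"
      using norm_triangle_ineq[of "blinfun_apply a x" "blinfun_apply a (v - x)"]
      by (simp add: blinfun.diff_right)
    also have "norm (blinfun_apply a (v - x)) \<le> M * norm (v - x)"
      by (rule norm_apply_le[OF a(1)])
    also have "\<dots> < e / 2"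
      using x(2) M_pos by (simp add: field_simps)
    finally show ?thesis
      using a(2) x(1) by force
  qed
  then show ?thesis
    using a(1) by blast
qed

end

section \<open>Central means of a weakly almost periodic module\<close>

lemma (in banach_space_over) scale_scaleR: "scale a (r *\<^sub>R v) = r *\<^sub>R scale a v"
  by (metis mult.commute scale_of_real scale_scale)

lemma (in banach_space_over) continuous_map_weak_topology_if:
  assumes "bounded_linear_over scale (*) F"
  shows "continuous_map (weak_topology scale) euclidean F"
proof -
  have "openin (weak_topology scale) (G -` U)" if "bounded_linear_over scale (*) G" "open U" for G U
    unfolding weak_topology_def by (rule topology_generated_by_Basis) (use that in blast)
  then have "openin (weak_topology scale) (F -` U)" if "open U" for U
    using assms that by blast
  moreover from this[of UNIV] have "topspace (weak_topology scale) = UNIV"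
    using openin_subset by fastforce
  ultimately show ?thesis
    by (auto simp: continuous_map_def vimage_def)
qed

text \<open>The weak topology is generated by scalar-valued functionals, whereas the arguments above
  use real ones. In the complex case \<open>F x = f x - i f (i x)\<close> is scalar-linear, and
  \<open>r\<close> is the real part.\<close>

lemma (in banach_space_over) real_functional_factors:
  fixes f :: "'v \<Rightarrow>\<^sub>L real"
  obtains F and r :: "'k \<Rightarrow> real"
  where "bounded_linear_over scale (*) F" "continuous_on UNIV r" "\<And>x. f x = r (F x)"
proof -
  consider (real) "\<forall>x::'k. \<exists>a. x = a *\<^sub>R 1"
    | (complex) i :: 'k where "i * i = - 1" "\<forall>x::'k. \<exists>a b. x = a *\<^sub>R 1 + b *\<^sub>R i"
    using real_or_complex by blast
  then show thesis
  proof cases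
    case real
    \<comment> \<open>This \<open>g\<close> plays the role of \<open>r\<close>; it inverts the
      embedding of the reals since \<open>g 1 = 1\<close>.\<close>
    obtain g :: "'k \<Rightarrow>\<^sub>L real" where g: "g 1 = norm (1::'k)"
      by (rule norming_functional)
    define F where "F x = (of_real (f x) :: 'k)" for x
    have "Vector_Spaces.linear scale (*) F"
    proof unfold_locales
      show "F (scale a x) = a * F x" for a x
      proof -
        obtain t where "a = of_real t"
          using real unfolding of_real_def by metis
        then show ?thesis
          by (simp add: F_def scale_of_real blinfun.scaleR_right)
      qed
    qed (auto simp: F_def blinfun.add_right algebra_simps)
    moreover have "norm (F x) \<le> norm x * norm f" for x
      using norm_blinfun[of f x] by (simp add: F_def mult.commute)
    ultimately have "bounded_linear_over scale (*) F"
      by (auto simp: bounded_linear_over_def)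
    moreover have "f x = g (F x)" for x
      using g by (simp add: F_def of_real_def blinfun.scaleR_right)
    moreover have "continuous_on UNIV (blinfun_apply g)"
      by (intro continuous_intros)
    ultimately show thesis
      using that by blast
  next
    case complex
    have norm_i: "norm i = 1"
    proof -
      have "norm i * norm i = 1"
        using arg_cong[OF complex(1), of norm] by (simp add: norm_mult)
      then show ?thesis
        using norm_ge_zero[of i] by (auto simp: square_eq_1_iff)
    qed
    \<comment> \<open>The bound comes from \<open>(a + b i) (a - b i) = a^2 + b^2\<close> and
      multiplicativity of the norm. The factor 2 is crude but yields continuity of the real
      part.\<close>
    have le: "a \<le> 2 * norm (a *\<^sub>R 1 + b *\<^sub>R i)" for a b
    proof -
      have "(a *\<^sub>R 1 + b *\<^sub>R i) * (a *\<^sub>R 1 - b *\<^sub>R i) = (a * a) *\<^sub>R 1 - (b * b) *\<^sub>R (i * i)"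
        by (simp add: algebra_simps)
      also have "\<dots> = (a * a + b * b) *\<^sub>R 1"
        by (simp add: complex(1) scaleR_add_left)
      finally have "norm (a *\<^sub>R 1 + b *\<^sub>R i) * norm (a *\<^sub>R 1 - b *\<^sub>R i) = norm ((a * a + b * b) *\<^sub>R (1::'k))"
        by (simp only: flip: norm_mult)
      also have "\<dots> = a * a + b * b"
        by simp
      finally have eq: "a * a + b * b = norm (a *\<^sub>R 1 + b *\<^sub>R i) * norm (a *\<^sub>R 1 - b *\<^sub>R i)" ..
      also have "\<dots> \<le> norm (a *\<^sub>R 1 + b *\<^sub>R i) * (\<bar>a\<bar> + \<bar>b\<bar>)"
        using norm_triangle_ineq4[of "a *\<^sub>R 1" "b *\<^sub>R i"] norm_i by (intro mult_left_mono) auto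
      finally have 1: "a * a + b * b \<le> norm (a *\<^sub>R 1 + b *\<^sub>R i) * (\<bar>a\<bar> + \<bar>b\<bar>)" .
      show ?thesis
      proof (rule ccontr)
        assume "\<not> ?thesis"
        then have a: "a > 0" "2 * norm (a *\<^sub>R 1 + b *\<^sub>R i) < a"
          using norm_ge_zero[of "a *\<^sub>R 1 + b *\<^sub>R i"] by linarith+
        then have "2 * norm (a *\<^sub>R 1 + b *\<^sub>R i) * (\<bar>a\<bar> + \<bar>b\<bar>) < a * (\<bar>a\<bar> + \<bar>b\<bar>)"
          by (intro mult_strict_right_mono) auto
        with 1 have "2 * (a * a + b * b) < a * a + a * \<bar>b\<bar>"
          using a(1) by (simp add: algebra_simps)
        moreover have "0 \<le> (a - \<bar>b\<bar>) * (a - \<bar>b\<bar>)"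
          by simp
        ultimately show False
          using abs_mult_self_eq[of b] zero_le_square[of b] zero_le_square[of a]
          by (simp add: algebra_simps)
      qed
    qed
    \<comment> \<open>The real part on the abstract field is obtained by extending the first
      coordinate along the map from \<open>(a, b)\<close> to \<open>a + b i\<close>.\<close>
    have "\<exists>g::'k \<Rightarrow> real. linear g \<and> (\<forall>x. g x \<le> 2 * norm x) \<and> (\<forall>a b. g (a *\<^sub>R 1 + b *\<^sub>R i) = a)"
    proof (rule hahn_banach_extension)
      show "sublinear (\<lambda>x::'k. 2 * norm x)"
        by (intro sublinear_mult sublinear_norm) simp
      show "linear (\<lambda>ab. fst ab *\<^sub>R (1::'k) + snd ab *\<^sub>R i)"
        by (rule linearI) (simp_all add: algebra_simps)
      show "linear (fst :: real \<times> real \<Rightarrow> real)"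
        by (rule bounded_linear.linear[OF bounded_linear_fst])
      show "fst ab \<le> 2 * norm (fst ab *\<^sub>R 1 + snd ab *\<^sub>R i)" for ab
        by (rule le)
    next
      fix g :: "'k \<Rightarrow> real"
      assume "linear g" "\<And>x. g x \<le> 2 * norm x"
        and "\<And>ab. ab \<in> UNIV \<Longrightarrow> g (fst ab *\<^sub>R 1 + snd ab *\<^sub>R i) = fst ab"
      then show ?thesis
        by (intro exI[of _ g]) (metis UNIV_I fst_conv snd_conv)
    qed (rule real_vector.subspace_UNIV)
    then obtain g :: "'k \<Rightarrow> real" where g: "linear g" "\<And>x. g x \<le> 2 * norm x"
      "\<And>a b. g (a *\<^sub>R 1 + b *\<^sub>R i) = a"
      by blast
    then obtain r :: "'k \<Rightarrow>\<^sub>L real" where r: "\<And>x. r x = g x"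
      using linear_le_norm_imp_blinfun[OF g(1), of 2] by blast
    define F where "F x = f x *\<^sub>R 1 - f (scale i x) *\<^sub>R i" for x
    have F_add: "F (x + y) = F x + F y" for x y
      by (simp add: F_def scale_right_distrib blinfun.add_right algebra_simps)
    have F_scaleR: "F (t *\<^sub>R x) = t *\<^sub>R F x" for t x
      by (simp add: F_def scale_scaleR blinfun.scaleR_right algebra_simps)
    have F_i: "F (scale i x) = i * F x" for x
    proof -
      have "scale i (scale i x) = - x"
        using complex(1) by (metis scale_minus_left scale_one scale_scale)
      then show ?thesis
        using complex(1) by (simp add: F_def blinfun.minus_right algebra_simps)
    qed
    have "Vector_Spaces.linear scale (*) F"
    proof unfold_locales
      show "F (scale a x) = a * F x" for a x
      proof -
        obtain t s where a: "a = t *\<^sub>R 1 + s *\<^sub>R i"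
          using complex(2) by blast
        then have "a = of_real t + of_real s * i"
          by (simp add: scaleR_conv_of_real)
        then have "scale a x = t *\<^sub>R x + s *\<^sub>R scale i x"
          by (simp add: scale_left_distrib scale_of_real flip: scale_scale)
        then show ?thesis
          by (simp add: F_add F_scaleR F_i a algebra_simps)
      qed
    qed (auto simp: F_add algebra_simps)
    moreover have "norm (F x) \<le> norm x * (2 * norm f)" for x
    proof -
      have "norm (F x) \<le> \<bar>f x\<bar> + \<bar>f (scale i x)\<bar>"
        using norm_triangle_ineq4[of "f x *\<^sub>R 1" "f (scale i x) *\<^sub>R i"] by (simp add: F_def norm_i)
      then show ?thesis
        using norm_blinfun[of f x] norm_blinfun[of f "scale i x"]
        by (simp add: norm_scale norm_i algebra_simps)
    qed
    ultimately have "bounded_linear_over scale (*) F"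
      by (auto simp: bounded_linear_over_def)
    moreover have "f x = r (F x)" for x
      using g(3)[of "f x" "- f (scale i x)"] by (simp add: r F_def)
    moreover have "continuous_on UNIV (blinfun_apply r)"
      by (intro continuous_intros)
    ultimately show thesis
      using that by blast
  qed
qed

lemma (in banach_space_over) continuous_map_weak_topology:
  fixes f :: "'v \<Rightarrow>\<^sub>L real"
  shows "continuous_map (weak_topology scale) euclidean (blinfun_apply f)"
proof -
  obtain F and r :: "'k \<Rightarrow> real" where F: "bounded_linear_over scale (*) F" "continuous_on UNIV r"
    "\<And>x. f x = r (F x)"
    using real_functional_factors[of f] by blast
  have "continuous_map (weak_topology scale) euclidean (r \<circ> F)"
    using continuous_map_weak_topology_if[OF F(1)] F(2)
    by (intro continuous_map_compose[where X' = euclidean]) auto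
  moreover have "blinfun_apply f = r \<circ> F"
    using F(3) by auto
  ultimately show ?thesis
    by simp
qed

lemmas blinfun_compose_bilinear = 
  bounded_bilinear.add_left[OF bounded_bilinear_blinfun_compose]
  bounded_bilinear.add_right[OF bounded_bilinear_blinfun_compose]
  bounded_bilinear.scaleR_left[OF bounded_bilinear_blinfun_compose]
  bounded_bilinear.scaleR_right[OF bounded_bilinear_blinfun_compose]

section \<open>The action as a bounded family of operators\<close>

context banach_module
begin

lemma bounded_linear_rho: "bounded_linear (\<rho> g)"
proof -
  interpret l: Vector_Spaces.linear scale scale "\<rho> g"
    using bounded_linear_action by (simp add: bounded_linear_over_def)
  obtain B where B: "\<And>v. norm (\<rho> g v) \<le> norm v * B"
    using bounded_linear_action by (auto simp: bounded_linear_over_def)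
  have "\<rho> g (r *\<^sub>R v) = r *\<^sub>R \<rho> g v" for r v
    using l.scale[of "of_real r" v] by (simp add: scale_of_real)
  then show ?thesis
    by (intro bounded_linear_intro[of "\<rho> g" B]) (auto simp: l.add B)
qed

lemma Blinfun_rho [simp]: "blinfun_apply (Blinfun (\<rho> g)) = \<rho> g"
  by (rule bounded_linear_Blinfun_apply[OF bounded_linear_rho])

lemma topspace_weak_topology: "topspace (weak_topology scale) = UNIV"
proof -
  obtain F and r :: "'k \<Rightarrow> real" where "bounded_linear_over scale (*) F"
    by (rule real_functional_factors)
  then have "openin (weak_topology scale) (F -` UNIV)"
    unfolding weak_topology_def by (intro topology_generated_by_Basis) blast
  then show ?thesis
    using openin_subset by fastforce
qed

lemma orbit_in_weakly_compact:
  assumes "wap_module scale \<rho>"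
  shows "\<exists>K. compactin (weak_topology scale) K \<and> range (\<lambda>g. \<rho> g v) \<subseteq> K"
  using assms closure_of_subset[of "range (\<lambda>g. \<rho> g v)" "weak_topology scale"]
  by (auto simp: wap_module_def relatively_weakly_compact_def topspace_weak_topology)

text \<open>Weakly compact sets are norm bounded, hence so are the orbits, and the uniform
  boundedness principle applies.\<close>

lemma wap_uniformly_bounded:
  assumes "wap_module scale \<rho>"
  shows "bounded (range (\<lambda>g. Blinfun (\<rho> g)))"
proof (rule uniform_boundedness)
  fix v
  obtain K where K: "compactin (weak_topology scale) K" "range (\<lambda>g. \<rho> g v) \<subseteq> K"
    using orbit_in_weakly_compact[OF assms] by blast
  have "bounded (blinfun_apply f ` K)" for f :: "'v \<Rightarrow>\<^sub>L real"
    using image_compactin[OF K(1) continuous_map_weak_topology[of f]] compact_imp_bounded by simp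
  then have "bounded K"
    by (rule weakly_bounded_imp_bounded)
  then show "bounded ((\<lambda>f. blinfun_apply f v) ` range (\<lambda>g. Blinfun (\<rho> g)))"
    using K(2) by (simp add: image_image bounded_subset)
qed

section \<open>Convex combinations of central operators\<close>

definition central_means :: "('v \<Rightarrow>\<^sub>L 'v) set"
  where "central_means = convex hull ((\<lambda>z. Blinfun (\<rho> z)) ` center)"

text \<open>Minimality of the convex hull as an induction rule, which avoids finite convex
  sums.\<close>

lemma central_means_induct [consumes 1, case_names convex center]:
  assumes "a \<in> central_means" and "convex {a. P a}" and "\<And>z. z \<in> center \<Longrightarrow> P (Blinfun (\<rho> z))"
  shows "P a"
proof -
  have "central_means \<subseteq> {a. P a}"
    unfolding central_means_def by (rule hull_minimal) (use assms in auto)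
  with assms(1) show ?thesis
    by blast
qed

lemma Blinfun_rho_in_central_means: "z \<in> center \<Longrightarrow> Blinfun (\<rho> z) \<in> central_means"
  unfolding central_means_def by (intro hull_inc) auto

lemma Blinfun_rho_add: "Blinfun (\<rho> g) o\<^sub>L Blinfun (\<rho> h) = Blinfun (\<rho> (g + h))"
  using fun_cong[OF action_add[of g h]] by (auto intro!: blinfun_eqI simp del: action_add)

lemma convex_central_means: "convex central_means"
  by (simp add: central_means_def)

lemma central_means_compose:
  assumes "a \<in> central_means" "b \<in> central_means"
  shows "a o\<^sub>L b \<in> central_means"
  using assms(1)
proof (induction a rule: central_means_induct)
  case convex
  show ?case
    unfolding convex_def
    by (auto simp: blinfun_compose_bilinear intro!: convexD[OF convex_central_means])
next
  case (center z)
  from assms(2) show ?case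
  proof (induction b rule: central_means_induct)
    case convex
    show ?case
      unfolding convex_def
      by (auto simp: blinfun_compose_bilinear intro!: convexD[OF convex_central_means])
  next
    case (center w)
    have "z + w \<in> center"
      unfolding center_def
    proof (intro CollectI allI)
      show "z + w + g = g + (z + w)" for g
      proof -
        have "w + g = g + w" "z + g = g + z"
          using \<open>z \<in> center\<close> center unfolding center_def by blast+
        then show ?thesis
          by (metis add.assoc)
      qed
    qed
    then show ?case
      by (simp add: Blinfun_rho_add Blinfun_rho_in_central_means)
  qed
qed

lemma central_means_commute:
  assumes "a \<in> central_means" "b \<in> central_means"
  shows "a o\<^sub>L b = b o\<^sub>L a"
  using assms(1)
proof (induction a rule: central_means_induct)
  case convex
  show ?case
    by (auto simp: convex_def blinfun_compose_bilinear)
next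
  case (center z)
  from assms(2) show ?case
  proof (induction b rule: central_means_induct)
    case convex
    show ?case
      by (auto simp: convex_def blinfun_compose_bilinear)
  next
    case (center w)
    then show ?case
      by (simp add: Blinfun_rho_add center_def)
  qed
qed

theorem small_central_mean:
  assumes "wap_module scale \<rho>" and fixed: "fixed_vectors \<rho> center = {0}"
    and "compact C" "e > 0"
  shows "\<exists>a\<in>central_means. \<forall>v\<in>C. norm (blinfun_apply a v) < e"
proof -
  obtain B where B: "\<And>g. norm (Blinfun (\<rho> g)) \<le> B"
    using wap_uniformly_bounded[OF assms(1)] by (auto simp: bounded_iff)
  have "0 \<in> (center :: 'g set)"
    by (simp add: center_def)
  \<comment> \<open>The bound \<open>\<bar>B\<bar> + 1\<close> is chosen to be positive.\<close>
  interpret operator_means central_means "\<bar>B\<bar> + 1"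
  proof
    have "Blinfun (\<rho> 0) = id_blinfun"
      using fun_cong[OF action_zero] by (auto intro!: blinfun_eqI)
    then show "id_blinfun \<in> central_means"
      using Blinfun_rho_in_central_means[OF \<open>0 \<in> center\<close>] by simp
    show "norm a \<le> \<bar>B\<bar> + 1" if "a \<in> central_means" for a
      using that
    proof (induction a rule: central_means_induct)
      case convex
      show ?case
        using convex_cball[of 0 "\<bar>B\<bar> + 1"] by (simp add: cball_def)
    next
      case (center z)
      show ?case
        using B[of z] by linarith
    qed
  qed (auto simp: convex_central_means central_means_compose central_means_commute)
  show ?thesis
  proof (rule small_mean_on_compact[OF _ \<open>compact C\<close> \<open>e > 0\<close>])
    fix v :: 'v and e :: real assume "e > 0"
    obtain K where K: "compactin (weak_topology scale) K" "range (\<lambda>g. \<rho> g v) \<subseteq> K"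
      using orbit_in_weakly_compact[OF assms(1)] by blast
    show "\<exists>a\<in>central_means. norm (blinfun_apply a v) < e"
    proof (rule mean_ergodic[OF continuous_map_weak_topology K(1) _ _ \<open>e > 0\<close>])
      fix f :: "'v \<Rightarrow>\<^sub>L real" and c a
      assume f: "\<And>x. x \<in> K \<Longrightarrow> blinfun_apply f x \<le> c" and a: "a \<in> central_means"
      from a show "blinfun_apply f (blinfun_apply a v) \<le> c"
      proof (induction a rule: central_means_induct)
        case convex
        show ?case
          by (auto simp: convex_def blinfun.add_left blinfun.scaleR_left blinfun.add_right
              blinfun.scaleR_right intro: convex_bound_le)
      next
        case (center z)
        show ?case
          using f K(2) by auto
      qed
    next
      fix u assume "\<And>a. a \<in> central_means \<Longrightarrow> blinfun_apply a u = u"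
      then have "\<rho> z u = u" if "z \<in> center" for z
        using Blinfun_rho_in_central_means[OF that] by (metis Blinfun_rho)
      then have "u \<in> fixed_vectors \<rho> center"
        by (simp add: fixed_vectors_def)
      then show "u = 0"
        using fixed by simp
    qed
  qed
qed

end

section \<open>The homotopy for translation by a central element\<close>

text \<open>The prism operator \<open>(x\<^sub>0, \<dots>, x\<^sub>m\<^sub>-\<^sub>1) \<mapsto> (x\<^sub>0, \<dots>, x\<^sub>i, x\<^sub>i + z, \<dots>, x\<^sub>m\<^sub>-\<^sub>1 + z)\<close>.\<close>

definition prism :: "nat \<Rightarrow> 'g::plus \<Rightarrow> nat \<Rightarrow> (nat \<Rightarrow> 'g) \<Rightarrow> nat \<Rightarrow> 'g"
  where "prism m z i x = (\<lambda>j\<in>{..<Suc m}. if j \<le> i then x j else x (j - 1) + z)"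

text \<open>The alternating sum over the prism is the chain homotopy between \<open>c\<close> and
  its translate by \<open>z\<close>; it lowers the number of arguments from \<open>m + 1\<close> to
  \<open>m\<close>. The value 0 off the carrier is the convention of
  \<open>continuous_maps\<close>.\<close>

definition homotopy ::
  "nat \<Rightarrow> 'g::{plus,topological_space} \<Rightarrow> ((nat \<Rightarrow> 'g) \<Rightarrow> 'v::real_normed_vector) \<Rightarrow> (nat \<Rightarrow> 'g) \<Rightarrow> 'v"
  where "homotopy m z c x =
    (if x \<in> topspace (power_space m) then \<Sum>i<m. (- 1) ^ i *\<^sub>R c (prism m z i x) else 0)"

section \<open>Faces of the prism simplices\<close>

lemma topspace_power_space: "topspace (power_space m) = {..<m} \<rightarrow>\<^sub>E UNIV"
  by (simp add: power_space_def)

lemma prism_in_power_space [simp]: "prism m z i x \<in> topspace (power_space (Suc m))"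
  by (auto simp: prism_def topspace_power_space)

lemma omit_in_power_space [simp]: "omit m k x \<in> topspace (power_space m)"
  by (auto simp: omit_def topspace_power_space)

lemma translate_in_power_space [simp]: "translate m h x \<in> topspace (power_space m)"
  by (auto simp: translate_def topspace_power_space)

lemma prism_translate: "i < m \<Longrightarrow> prism m z i (translate m h x) = translate (Suc m) h (prism m z i x)"
  by (rule ext) (auto simp: prism_def translate_def add.assoc)

lemma omit_prism_less:
  assumes "k < i" "i \<le> m"
  shows "omit (Suc m) k (prism (Suc m) z i x) = prism m z (i - 1) (omit m k x)"
  using assms by (intro ext) (auto simp: omit_def prism_def)

lemma omit_prism_greater:
  assumes "Suc i < k" "k \<le> Suc m"
  shows "omit (Suc m) k (prism (Suc m) z i x) = prism m z i (omit m (k - 1) x)"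
  using assms by (intro ext) (auto simp: omit_def prism_def)

text \<open>Consecutive simplices of the prism share this face, so that it cancels in the
  alternating sum.\<close>

lemma omit_Suc_prism: "omit (Suc m) (Suc i) (prism (Suc m) z i x) = omit (Suc m) (Suc i) (prism (Suc m) z (Suc i) x)"
  by (rule ext) (auto simp: omit_def prism_def)

text \<open>\<open>Q\<close> stands for the faces shared by neighbours and \<open>F\<close> for the
  signed simplices over the faces of \<open>x\<close>; the minus signs at \<open>F\<close> come from
  the index shifts in the simplicial identities.\<close>

lemma sum_prism_row:
  fixes F :: "nat \<Rightarrow> nat \<Rightarrow> 'v::ab_group_add"
  assumes "i \<le> m"
  shows "(\<Sum>k\<le>Suc m. if k < i then - F k (i - 1) else if k = i then Q i
      else if k = Suc i then - Q (Suc i) else - F (k - 1) i) =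
    Q i - Q (Suc i) - (\<Sum>k<i. F k (i - 1)) - (\<Sum>k=Suc i..m. F k i)"
    (is "(\<Sum>k\<le>Suc m. ?t k) = _")
proof -
  have "{..Suc m} = {..<i} \<union> ({i, Suc i} \<union> {Suc (Suc i)..Suc m})"
    using assms by auto
  then have "(\<Sum>k\<le>Suc m. ?t k) = (\<Sum>k<i. ?t k) + (\<Sum>k\<in>{i, Suc i} \<union> {Suc (Suc i)..Suc m}. ?t k)"
    by (simp only:) (rule sum.union_disjoint; auto)
  also have "(\<Sum>k\<in>{i, Suc i} \<union> {Suc (Suc i)..Suc m}. ?t k) =
      (\<Sum>k\<in>{i, Suc i}. ?t k) + (\<Sum>k=Suc (Suc i)..Suc m. ?t k)"
    by (rule sum.union_disjoint) auto
  also have "(\<Sum>k=Suc (Suc i)..Suc m. ?t k) = (\<Sum>k=Suc i..m. - F k i)"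
    unfolding sum.shift_bounds_cl_Suc_ivl by (rule sum.cong) auto
  also have "(\<Sum>k<i. ?t k) = (\<Sum>k<i. - F k (i - 1))"
    by (rule sum.cong) auto
  finally show ?thesis
    by (simp add: sum_negf)
qed

text \<open>The \<open>Q\<close> terms telescope, and the two triangles of indices
  \<open>k \<le> i\<close> and \<open>k > i\<close> fill the rectangle, after a shift in the first
  one.\<close>

lemma sum_prism:
  fixes F :: "nat \<Rightarrow> nat \<Rightarrow> 'v::ab_group_add"
  shows "(\<Sum>i\<le>m. Q i - Q (Suc i) - (\<Sum>k<i. F k (i - 1)) - (\<Sum>k=Suc i..m. F k i)) =
    Q 0 - Q (Suc m) - (\<Sum>k\<le>m. \<Sum>i<m. F k i)"
proof -
  have "(\<Sum>i\<le>m. \<Sum>k<i. F k (i - 1)) = (\<Sum>i<m. \<Sum>k\<le>i. F k i)"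
    by (cases m) (simp_all add: sum.atMost_Suc_shift lessThan_Suc_atMost del: sum.atMost_Suc)
  moreover have "(\<Sum>i\<le>m. \<Sum>k=Suc i..m. F k i) = (\<Sum>i<m. \<Sum>k=Suc i..m. F k i)"
    by (simp flip: lessThan_Suc_atMost)
  moreover have "(\<Sum>k\<le>i. F k i) + (\<Sum>k=Suc i..m. F k i) = (\<Sum>k\<le>m. F k i)" if "i < m" for i
  proof -
    have "{..m} = {..i} \<union> {Suc i..m}"
      using that by auto
    then show ?thesis
      by (simp only:) (subst sum.union_disjoint; auto)
  qed
  ultimately have "(\<Sum>i\<le>m. \<Sum>k<i. F k (i - 1)) + (\<Sum>i\<le>m. \<Sum>k=Suc i..m. F k i) = (\<Sum>i<m. \<Sum>k\<le>m. F k i)"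
    by (simp flip: sum.distrib)
  also have "\<dots> = (\<Sum>k\<le>m. \<Sum>i<m. F k i)"
    by (rule sum.swap)
  finally show ?thesis
    using sum_telescope[of Q m] by (simp add: sum_subtractf sum.distrib algebra_simps)
qed

text \<open>The cocycle identity is summed with signs over all simplices of the prism. Inner faces
  cancel, the faces over the boundary give the differential of the homotopy, and the two ends of the
  prism remain.\<close>

lemma differential_homotopy:
  fixes c :: "(nat \<Rightarrow> 'g::topological_group_add) \<Rightarrow> 'v::real_normed_vector"
  assumes z: "z \<in> center" and cocycle: "differential (Suc m) c = (\<lambda>_. 0)"
    and x: "x \<in> topspace (power_space (Suc m))"
  shows "differential m (homotopy m z c) x = c (translate (Suc m) z x) - c x"
proof -
  define F where "F k i = (- 1) ^ (k + i) *\<^sub>R c (prism m z i (omit m k x))" for k i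
  define Q where "Q i = c (omit (Suc m) i (prism (Suc m) z i x))" for i
  have "0 = (\<Sum>i\<le>m. (- 1) ^ i *\<^sub>R differential (Suc m) c (prism (Suc m) z i x))"
    using cocycle by simp
  also have "\<dots> = (\<Sum>i\<le>m. \<Sum>k\<le>Suc m. (- 1) ^ (i + k) *\<^sub>R c (omit (Suc m) k (prism (Suc m) z i x)))"
    by (simp add: differential_def scaleR_sum_right power_add del: sum.atMost_Suc)
  also have "\<dots> = (\<Sum>i\<le>m. \<Sum>k\<le>Suc m. if k < i then - F k (i - 1) else if k = i then Q i
      else if k = Suc i then - Q (Suc i) else - F (k - 1) i)"
  proof (intro sum.cong refl)
    fix i k assume "i \<in> {..m}" "k \<in> {..Suc m}"
    then have ik: "i \<le> m" "k \<le> Suc m"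
      by auto
    consider "k < i" | "k = i" | "k = Suc i" | "Suc i < k"
      by linarith
    then show "(- 1) ^ (i + k) *\<^sub>R c (omit (Suc m) k (prism (Suc m) z i x)) =
      (if k < i then - F k (i - 1) else if k = i then Q i
        else if k = Suc i then - Q (Suc i) else - F (k - 1) i)"
    proof cases
      case 1
      then obtain j where "i = Suc j"
        by (cases i) auto
      with 1 ik show ?thesis
        by (simp add: omit_prism_less F_def add.commute)
    next
      case 2
      then show ?thesis
        by (simp add: Q_def)
    next
      case 3
      then show ?thesis
        by (simp add: Q_def omit_Suc_prism)
    next
      case 4
      then obtain j where "k = Suc j"
        by (cases k) auto
      with 4 ik show ?thesis
        by (simp add: omit_prism_greater F_def add.commute)
    qed
  qed
  also have "\<dots> = (\<Sum>i\<le>m. Q i - Q (Suc i) - (\<Sum>k<i. F k (i - 1)) - (\<Sum>k=Suc i..m. F k i))"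
    by (intro sum.cong refl sum_prism_row) simp
  also have "\<dots> = Q 0 - Q (Suc m) - (\<Sum>k\<le>m. \<Sum>i<m. F k i)"
    by (rule sum_prism)
  also have "(\<Sum>k\<le>m. \<Sum>i<m. F k i) = differential m (homotopy m z c) x"
    using x by (simp add: differential_def homotopy_def F_def scaleR_sum_right power_add)
  \<comment> \<open>Centrality enters here: the prism adds \<open>z\<close> on the right, while
    \<open>translate\<close> acts on the left.\<close>
  also have "Q 0 = c (translate (Suc m) z x)"
  proof -
    have "g + z = z + g" for g :: 'g
      using z by (auto simp: center_def)
    then have "omit (Suc m) 0 (prism (Suc m) z 0 x) = translate (Suc m) z x"
      by (intro ext) (auto simp: omit_def prism_def translate_def)
    then show ?thesis
      by (simp add: Q_def)
  qed
  also have "Q (Suc m) = c x"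
  proof -
    have "omit (Suc m) (Suc m) (prism (Suc m) z (Suc m) x) = x"
      using x by (intro ext) (auto simp: omit_def prism_def topspace_power_space PiE_def extensional_def)
    then show ?thesis
      by (simp add: Q_def)
  qed
  finally show ?thesis
    by simp
qed

section \<open>Continuity and equivariance of the homotopy\<close>

lemma continuous_map_coordinate:
  "i < m \<Longrightarrow> continuous_map (power_space m) euclidean (\<lambda>x. x i)"
  unfolding power_space_def
  using continuous_map_product_projection[of i "{..<m}" "\<lambda>_. euclidean"] by simp

lemma continuous_map_prism:
  fixes z :: "'g::topological_monoid_add"
  assumes "i < m"
  shows "continuous_map (power_space m) (power_space (Suc m)) (prism m z i)"
  unfolding power_space_def[of "Suc m"]
proof (subst continuous_map_componentwise, intro conjI ballI)
  show "prism m z i ` topspace (power_space m) \<subseteq> extensional {..<Suc m}"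
    by (auto simp: prism_def)
  fix j assume "j \<in> {..<Suc m}"
  then have j: "j \<le> m"
    by simp
  show "continuous_map (power_space m) euclidean (\<lambda>x. prism m z i x j)"
  proof (cases "j \<le> i")
    case True
    then show ?thesis
      using continuous_map_coordinate[of j m] assms j by (simp add: prism_def)
  next
    case False
    then have "continuous_map (power_space m) euclidean (\<lambda>x. x (j - 1) :: 'g)"
      using j by (intro continuous_map_coordinate) auto
    moreover have "continuous_map euclidean euclidean (\<lambda>y. y + z)"
      by (auto intro!: continuous_intros)
    ultimately have "continuous_map (power_space m) euclidean ((\<lambda>y. y + z) \<circ> (\<lambda>x. x (j - 1)))"
      by (rule continuous_map_compose)
    then show ?thesis
      using False j by (simp add: prism_def comp_def)
  qed
qed

text \<open>Adding \<open>z\<close> on the right commutes with left translation by associativity, so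
  equivariance is inherited from \<open>c\<close>.\<close>

lemma homotopy_equivariant:
  assumes c: "c \<in> equivariant_maps \<rho> (Suc m)" and lin: "\<And>g. linear (\<rho> g)"
  shows "homotopy m z c \<in> equivariant_maps \<rho> m"
proof -
  have c_cont: "continuous_map (power_space (Suc m)) euclidean c"
    and c_eq: "\<And>h x. x \<in> topspace (power_space (Suc m)) \<Longrightarrow> c (translate (Suc m) h x) = \<rho> h (c x)"
    using c by (auto simp: equivariant_maps_def continuous_maps_def)
  have "continuous_map (power_space m) euclidean (\<lambda>x. \<Sum>i<m. (- 1) ^ i *\<^sub>R c (prism m z i x))"
  proof (rule continuous_map_sum)
    fix i assume "i \<in> {..<m}"
    then have "continuous_map (power_space m) euclidean (c \<circ> prism m z i)"
      by (intro continuous_map_compose[OF continuous_map_prism c_cont]) simp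
    moreover have "continuous_map euclidean euclidean (\<lambda>v::'b. (- 1) ^ i *\<^sub>R v)"
      by (auto intro!: continuous_intros)
    ultimately have "continuous_map (power_space m) euclidean ((\<lambda>v. (- 1) ^ i *\<^sub>R v) \<circ> (c \<circ> prism m z i))"
      by (rule continuous_map_compose)
    then show "continuous_map (power_space m) euclidean (\<lambda>x. (- 1) ^ i *\<^sub>R c (prism m z i x))"
      by (simp add: comp_def)
  qed simp
  then have "homotopy m z c \<in> continuous_maps (power_space m)"
    unfolding continuous_maps_def
    by (auto simp: homotopy_def elim!: continuous_map_eq)
  moreover have "homotopy m z c (translate m h x) = \<rho> h (homotopy m z c x)"
    if "x \<in> topspace (power_space m)" for h x
    using that
    by (simp add: homotopy_def prism_translate c_eq linear_sum[OF lin] linear_scale[OF lin])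
  ultimately show ?thesis
    by (simp add: equivariant_maps_def)
qed

section \<open>Approximation in the compact-open topology\<close>

text \<open>Along the generation of the topology, intersections take the union of the compact sets
  and the smaller radius; a subbasic set admits a radius because the image of \<open>K\<close> under
  \<open>c\<close> is compact.\<close>

lemma openin_compact_open_topologyD:
  assumes "openin (compact_open_topology X) T" "c \<in> T" "c \<in> continuous_maps X"
  shows "\<exists>K e. compactin X K \<and> e > 0 \<and>
    (\<forall>b\<in>continuous_maps X. (\<forall>x\<in>K. dist (c x) (b x) < e) \<longrightarrow> b \<in> T)"
proof -
  let ?\<S> = "{{c \<in> continuous_maps X. c ` K \<subseteq> U} | K U. compactin X K \<and> open U}"
  have "generate_topology_on ?\<S> T"
    using assms(1) by (simp add: compact_open_topology_def openin_topology_generated_by_iff)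
  then show ?thesis
    using assms(2)
  proof (induction T rule: generate_topology_on.induct)
    case Empty
    then show ?case
      by simp
  next
    case (Int S T)
    then obtain K e L d where "compactin X K" "e > 0"
      "\<forall>b\<in>continuous_maps X. (\<forall>x\<in>K. dist (c x) (b x) < e) \<longrightarrow> b \<in> S"
      "compactin X L" "d > 0"
      "\<forall>b\<in>continuous_maps X. (\<forall>x\<in>L. dist (c x) (b x) < d) \<longrightarrow> b \<in> T"
      by blast
    then show ?case
      by (intro exI[of _ "K \<union> L"] exI[of _ "min e d"]) (auto simp: compactin_Un)
  next
    case (UN \<T>)
    then obtain S where S: "S \<in> \<T>" "c \<in> S"
      by blast
    then obtain K e where "compactin X K" "e > 0"
      "\<forall>b\<in>continuous_maps X. (\<forall>x\<in>K. dist (c x) (b x) < e) \<longrightarrow> b \<in> S"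
      using UN.IH by blast
    with S(1) show ?case
      by (intro exI[of _ K] exI[of _ e]) blast
  next
    case (Basis S)
    then obtain K U where K: "compactin X K" "open U" "S = {c \<in> continuous_maps X. c ` K \<subseteq> U}"
      by auto
    have "continuous_map X euclidean c"
      using assms(3) by (simp add: continuous_maps_def)
    then have "compact (c ` K)"
      using image_compactin[OF K(1)] by fastforce
    moreover have "c ` K \<subseteq> U"
      using Basis K(3) by auto
    ultimately obtain e where "e > 0" and e: "(\<Union>y\<in>c ` K. ball y e) \<subseteq> U"
      using compact_subset_open_imp_ball_epsilon_subset[OF _ K(2)] by metis
    have "b x \<in> U" if "x \<in> K" "dist (c x) (b x) < e" for b x
      using subsetD[OF e, of "b x"] that by auto
    then show ?case
      using K \<open>e > 0\<close> by (intro exI[of _ K] exI[of _ e]) auto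
  qed
qed

text \<open>\<open>K\<close> is cut into finitely many compact pieces \<open>L x\<close> on which
  \<open>c\<close> stays within \<open>e / 4\<close> of \<open>c x\<close>; on each of them the
  values of \<open>b\<close> are confined to the ball of radius \<open>e / 2\<close> around
  \<open>c x\<close>.\<close>

lemma compact_open_topology_neighbourhood:
  assumes c: "c \<in> continuous_maps X" and K: "compactin X K" and "e > 0"
  shows "\<exists>T. openin (compact_open_topology X) T \<and> c \<in> T \<and> (\<forall>b\<in>T. \<forall>x\<in>K. dist (c x) (b x) < e)"
proof -
  have cont: "continuous_map X euclidean c"
    using c by (simp add: continuous_maps_def)
  obtain F where F: "finite F" "F \<subseteq> K" "\<And>y. y \<in> K \<Longrightarrow> \<exists>x\<in>F. dist (c x) (c y) < e / 4"
    using continuous_map_finite_net[OF K, of "{()}" "\<lambda>_. c" "e / 4"] cont \<open>e > 0\<close> by auto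
  define L where "L x = K \<inter> {y \<in> topspace X. c y \<in> cball (c x) (e / 4)}" for x
  have L: "compactin X (L x)" for x
    unfolding L_def by (rule compact_Int_closedin[OF K closedin_continuous_map_preimage[OF cont]]) auto
  define V where "V x = {b \<in> continuous_maps X. b ` L x \<subseteq> ball (c x) (e / 2)}" for x
  have "openin (compact_open_topology X) (V x)" for x
    unfolding compact_open_topology_def V_def
    by (rule topology_generated_by_Basis) (use L in blast)
  then have "openin (compact_open_topology X) (continuous_maps X \<inter> (\<Inter>x\<in>F. V x))"
    using F(1) openin_topspace[of "compact_open_topology X"]
    by (cases "F = {}") (auto intro!: openin_Int openin_INT2)
  moreover have "c \<in> continuous_maps X \<inter> (\<Inter>x\<in>F. V x)"
    using c \<open>e > 0\<close> by (force simp: V_def L_def)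
  moreover have "dist (c y) (b y) < e" if b: "b \<in> continuous_maps X \<inter> (\<Inter>x\<in>F. V x)" and "y \<in> K" for b y
  proof -
    obtain x where x: "x \<in> F" "dist (c x) (c y) < e / 4"
      using F(3) \<open>y \<in> K\<close> by blast
    have "y \<in> L x"
      using x(2) \<open>y \<in> K\<close> compactin_subset_topspace[OF K] by (auto simp: L_def)
    moreover have "b ` L x \<subseteq> ball (c x) (e / 2)"
      using b x(1) by (simp add: V_def)
    ultimately have "b y \<in> ball (c x) (e / 2)"
      by blast
    then show ?thesis
      using x(2) dist_triangle[of "c y" "b y" "c x"] \<open>e > 0\<close> by (simp add: dist_commute)
  qed
  ultimately show ?thesis
    by blast
qed

text \<open>This reduces closures to uniform approximation on compact sets, the form in which the
  small central means are applied.\<close>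

lemma in_compact_open_closure_iff:
  assumes "B \<subseteq> continuous_maps X"
  shows "c \<in> compact_open_topology X closure_of B \<longleftrightarrow>
    c \<in> continuous_maps X \<and> (\<forall>K e. compactin X K \<longrightarrow> e > 0 \<longrightarrow> (\<exists>b\<in>B. \<forall>x\<in>K. dist (c x) (b x) < e))"
proof (intro iffI conjI allI impI)
  assume c: "c \<in> compact_open_topology X closure_of B"
  then show c': "c \<in> continuous_maps X"
    by (simp add: in_closure_of)
  fix K and e :: real assume "compactin X K" "e > 0"
  then obtain T where "openin (compact_open_topology X) T" "c \<in> T" "\<forall>b\<in>T. \<forall>x\<in>K. dist (c x) (b x) < e"
    using compact_open_topology_neighbourhood[OF c'] by meson
  moreover obtain b where "b \<in> B" "b \<in> T"
    using c calculation(1,2) unfolding in_closure_of by meson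
  ultimately show "\<exists>b\<in>B. \<forall>x\<in>K. dist (c x) (b x) < e"
    by blast
next
  assume c: "c \<in> continuous_maps X \<and>
    (\<forall>K e. compactin X K \<longrightarrow> e > 0 \<longrightarrow> (\<exists>b\<in>B. \<forall>x\<in>K. dist (c x) (b x) < e))"
  have "\<exists>b. b \<in> B \<and> b \<in> T" if T: "c \<in> T" "openin (compact_open_topology X) T" for T
  proof -
    obtain K e where "compactin X K" "e > 0"
      and sub: "\<And>b. b \<in> continuous_maps X \<Longrightarrow> \<forall>x\<in>K. dist (c x) (b x) < e \<Longrightarrow> b \<in> T"
      using openin_compact_open_topologyD[OF T(2,1) conjunct1[OF c]] by (elim exE conjE) simp
    then obtain b where b: "b \<in> B" "\<forall>x\<in>K. dist (c x) (b x) < e"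
      using conjunct2[OF c] by meson
    then have "b \<in> T"
      using assms by (intro sub) auto
    with b(1) show ?thesis
      by blast
  qed
  then show "c \<in> compact_open_topology X closure_of B"
    using c by (simp add: in_closure_of)
qed

section \<open>Vanishing of the reduced cohomology\<close>

lemma continuous_maps_lincomb:
  fixes b c :: "'a \<Rightarrow> 'v::real_normed_vector"
  assumes "b \<in> continuous_maps X" "c \<in> continuous_maps X"
  shows "(\<lambda>x. s *\<^sub>R b x + t *\<^sub>R c x) \<in> continuous_maps X"
proof -
  have scale: "continuous_map X euclidean (\<lambda>x. r *\<^sub>R f x)" if "continuous_map X euclidean f"
    for r and f :: "'a \<Rightarrow> 'v"
  proof -
    have "continuous_map euclidean euclidean (\<lambda>v::'v. r *\<^sub>R v)"
      by (auto intro!: continuous_intros)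
    then show ?thesis
      using continuous_map_compose[OF that, of euclidean "\<lambda>v. r *\<^sub>R v"] by (simp add: comp_def)
  qed
  then show ?thesis
    using assms by (auto simp: continuous_maps_def intro!: continuous_map_add scale)
qed

lemma differential_lincomb:
  "differential m (\<lambda>x. s *\<^sub>R b x + t *\<^sub>R c x) = (\<lambda>x. s *\<^sub>R differential m b x + t *\<^sub>R differential m c x)"
  by (rule ext) (simp add: differential_def scaleR_add_right sum.distrib scaleR_sum_right mult.commute del: sum.atMost_Suc)

lemma continuous_map_omit:
  "continuous_map (power_space (Suc m) :: (nat \<Rightarrow> 'g::topological_space) topology) (power_space m) (omit m k)"
  unfolding power_space_def[of m]
proof (subst continuous_map_componentwise, intro conjI ballI)
  show "omit m k ` topspace (power_space (Suc m)) \<subseteq> extensional {..<m}"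
    by (auto simp: omit_def)
  fix j assume "j \<in> {..<m}"
  then show "continuous_map (power_space (Suc m)) euclidean (\<lambda>x. omit m k x j :: 'g)"
    using continuous_map_coordinate[of j "Suc m", where 'a = 'g]
      continuous_map_coordinate[of "Suc j" "Suc m", where 'a = 'g]
    by (simp add: omit_def)
qed

lemma differential_continuous:
  fixes c :: "(nat \<Rightarrow> 'g::topological_space) \<Rightarrow> 'v::real_normed_vector"
  assumes "c \<in> continuous_maps (power_space m)"
  shows "differential m c \<in> continuous_maps (power_space (Suc m))"
proof -
  have c: "continuous_map (power_space m) euclidean c"
    using assms by (simp add: continuous_maps_def)
  have "continuous_map (power_space (Suc m)) euclidean (\<lambda>x. \<Sum>k\<le>m. (- 1) ^ k *\<^sub>R c (omit m k x))"
  proof (rule continuous_map_sum)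
    fix k
    have "continuous_map euclidean euclidean (\<lambda>v::'v. (- 1) ^ k *\<^sub>R v)"
      by (auto intro!: continuous_intros)
    with continuous_map_compose[OF continuous_map_omit c]
    have "continuous_map (power_space (Suc m)) euclidean ((\<lambda>v. (- 1) ^ k *\<^sub>R v) \<circ> (c \<circ> omit m k))"
      by (rule continuous_map_compose)
    then show "continuous_map (power_space (Suc m)) euclidean (\<lambda>x. (- 1) ^ k *\<^sub>R c (omit m k x))"
      by (simp add: comp_def)
  qed simp
  then show ?thesis
    unfolding continuous_maps_def by (auto simp: differential_def elim!: continuous_map_eq)
qed

context banach_module
begin

lemma linear_rho: "linear (\<rho> g)"
  by (rule bounded_linear.linear[OF bounded_linear_rho])

end

lemma equivariant_maps_lincomb:
  assumes "\<And>g. linear (\<rho> g)" "b \<in> equivariant_maps \<rho> m" "c \<in> equivariant_maps \<rho> m"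
  shows "(\<lambda>x. s *\<^sub>R b x + t *\<^sub>R c x) \<in> equivariant_maps \<rho> m"
  using assms
  by (auto simp: equivariant_maps_def continuous_maps_lincomb linear_add linear_scale)

lemma coboundaries_lincomb:
  assumes lin: "\<And>g. linear (\<rho> g)" and "b \<in> coboundaries \<rho> n" "c \<in> coboundaries \<rho> n"
  shows "(\<lambda>x. s *\<^sub>R b x + t *\<^sub>R c x) \<in> coboundaries \<rho> n"
proof (cases "n = 0")
  case True
  then show ?thesis
    using assms by (simp add: coboundaries_def)
next
  case False
  then obtain b' c' where "b' \<in> equivariant_maps \<rho> n" "c' \<in> equivariant_maps \<rho> n"
    "b = differential n b'" "c = differential n c'"
    using assms by (auto simp: coboundaries_def)
  then show ?thesis
    using False equivariant_maps_lincomb[OF lin \<open>b' \<in> equivariant_maps \<rho> n\<close> \<open>c' \<in> equivariant_maps \<rho> n\<close>, of s t]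
    by (auto simp: coboundaries_def simp flip: differential_lincomb)
qed

lemma coboundaries_continuous: "coboundaries \<rho> n \<subseteq> continuous_maps (power_space (Suc n))"
  using differential_continuous
  by (auto simp: coboundaries_def equivariant_maps_def) (auto simp: continuous_maps_def)

lemma in_closed_coboundaries_iff:
  "c \<in> closed_coboundaries \<rho> n \<longleftrightarrow> c \<in> continuous_maps (power_space (Suc n)) \<and>
    (\<forall>K e. compactin (power_space (Suc n)) K \<longrightarrow> e > 0 \<longrightarrow>
      (\<exists>b\<in>coboundaries \<rho> n. \<forall>x\<in>K. dist (c x) (b x) < e))"
  unfolding closed_coboundaries_def by (rule in_compact_open_closure_iff[OF coboundaries_continuous])

lemma closed_coboundaries_lincomb:
  fixes \<rho> :: "'g::topological_group_add \<Rightarrow> 'v::real_normed_vector \<Rightarrow> 'v"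
  assumes lin: "\<And>g. linear (\<rho> g)"
    and b: "b \<in> closed_coboundaries \<rho> n" and c: "c \<in> closed_coboundaries \<rho> n"
  shows "(\<lambda>x. s *\<^sub>R b x + t *\<^sub>R c x) \<in> closed_coboundaries \<rho> n"
  unfolding in_closed_coboundaries_iff
proof (intro conjI allI impI)
  show "(\<lambda>x. s *\<^sub>R b x + t *\<^sub>R c x) \<in> continuous_maps (power_space (Suc n))"
    using b c by (intro continuous_maps_lincomb) (auto simp: in_closed_coboundaries_iff)
  fix K :: "(nat \<Rightarrow> 'g) set" and e :: real
  assume K: "compactin (power_space (Suc n)) K" and "e > 0"
  \<comment> \<open>The summand 1 makes \<open>M\<close> positive and the final estimate
    strict.\<close>
  define M where "M = \<bar>s\<bar> + \<bar>t\<bar> + 1"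
  have "M > 0" "e / M > 0"
    using \<open>e > 0\<close> by (auto simp: M_def)
  obtain b' where b': "b' \<in> coboundaries \<rho> n" "\<forall>x\<in>K. dist (b x) (b' x) < e / M"
    using b K \<open>e / M > 0\<close> unfolding in_closed_coboundaries_iff by blast
  obtain c' where c': "c' \<in> coboundaries \<rho> n" "\<forall>x\<in>K. dist (c x) (c' x) < e / M"
    using c K \<open>e / M > 0\<close> unfolding in_closed_coboundaries_iff by blast
  have dist_scale: "dist (r *\<^sub>R u) (r *\<^sub>R v) = \<bar>r\<bar> * dist u v" for r and u v :: 'v
    by (simp add: dist_norm flip: scaleR_diff_right)
  have "dist (s *\<^sub>R b x + t *\<^sub>R c x) (s *\<^sub>R b' x + t *\<^sub>R c' x) < e" if "x \<in> K" for x
  proof -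
    have "dist (s *\<^sub>R b x + t *\<^sub>R c x) (s *\<^sub>R b' x + t *\<^sub>R c' x) \<le>
        \<bar>s\<bar> * dist (b x) (b' x) + \<bar>t\<bar> * dist (c x) (c' x)"
      using dist_triangle_add[of "s *\<^sub>R b x" "t *\<^sub>R c x" "s *\<^sub>R b' x" "t *\<^sub>R c' x"]
      by (simp add: dist_scale)
    also have "\<dots> \<le> \<bar>s\<bar> * (e / M) + \<bar>t\<bar> * (e / M)"
      using b'(2) c'(2) that by (intro add_mono mult_left_mono) (auto simp: less_imp_le)
    also have "\<dots> = e * ((\<bar>s\<bar> + \<bar>t\<bar>) / M)"
      by (simp add: add_divide_distrib algebra_simps)
    also have "\<dots> < e * 1"
      using \<open>e > 0\<close> \<open>M > 0\<close> by (intro mult_strict_left_mono) (auto simp: M_def field_simps)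
    finally show ?thesis
      by simp
  qed
  then show "\<exists>d\<in>coboundaries \<rho> n. \<forall>x\<in>K. dist (s *\<^sub>R b x + t *\<^sub>R c x) (d x) < e"
    by (intro bexI[OF _ coboundaries_lincomb[OF lin b'(1) c'(1), of s t]]) simp
qed

lemma zero_mem_equivariant_maps:
  assumes "\<And>g. linear (\<rho> g)"
  shows "(\<lambda>_. 0) \<in> equivariant_maps \<rho> m"
  by (simp add: equivariant_maps_def continuous_maps_def linear_0[OF assms])

text \<open>By equivariance the translate of \<open>c\<close> by \<open>z\<close> is
  \<open>\<rho> z \<circ> c\<close>, so the prism homotopy of \<open>c\<close>, a cochain of degree
  \<open>n - 1\<close>, has \<open>\<rho> z \<circ> c - c\<close> as its differential.\<close>

lemma cocycle_translate_cohomologous: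
  fixes \<rho> :: "'g::topological_group_add \<Rightarrow> 'v::real_normed_vector \<Rightarrow> 'v"
  assumes lin: "\<And>g. linear (\<rho> g)" and c: "c \<in> cocycles \<rho> n" and "n > 0" and z: "z \<in> center"
  shows "(\<lambda>x. c x - \<rho> z (c x)) \<in> coboundaries \<rho> n"
proof -
  have c': "c \<in> equivariant_maps \<rho> (Suc n)" "differential (Suc n) c = (\<lambda>_. 0)"
    using c by (auto simp: cocycles_def)
  have hom: "homotopy n z c \<in> equivariant_maps \<rho> n"
    by (rule homotopy_equivariant[OF c'(1) lin])
  have "differential n (homotopy n z c) x = \<rho> z (c x) - c x" for x
  proof (cases "x \<in> topspace (power_space (Suc n))")
    case True
    then show ?thesis
      using differential_homotopy[OF z c'(2) True] c'(1) by (simp add: equivariant_maps_def)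
  next
    case False
    then show ?thesis
      using c'(1) by (simp add: differential_def equivariant_maps_def continuous_maps_def linear_0[OF lin])
  qed
  then have "(\<lambda>x. \<rho> z (c x) - c x) = differential n (homotopy n z c)"
    by auto
  then have "(\<lambda>x. \<rho> z (c x) - c x) \<in> coboundaries \<rho> n"
    using hom \<open>n > 0\<close> by (simp add: coboundaries_def)
  from coboundaries_lincomb[OF lin this this, of "- 1" 0] show ?thesis
    by simp
qed

text \<open>A cocycle of degree 0 is constant, and equivariance makes its value invariant. The
  second alternative covers points off the carrier.\<close>

lemma zero_cocycle_fixed:
  fixes \<rho> :: "'g::topological_group_add \<Rightarrow> 'v::real_normed_vector \<Rightarrow> 'v"
  assumes c: "c \<in> cocycles \<rho> 0"
  shows "\<rho> h (c x) = c x \<or> c x = 0"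
proof (cases "x \<in> topspace (power_space 1)")
  case True
  define y :: "nat \<Rightarrow> 'g" where "y = translate 1 h x"
  \<comment> \<open>This is the pair \<open>(x 0, h + x 0)\<close>, whose faces are \<open>y\<close>
    and \<open>x\<close>.\<close>
  define w :: "nat \<Rightarrow> 'g" where "w = (\<lambda>i\<in>{..<Suc 1}. if i = 0 then x 0 else y 0)"
  have "w \<in> topspace (power_space (Suc 1))"
    by (auto simp: w_def topspace_power_space)
  moreover have "omit 1 0 w = y"
    by (rule ext) (auto simp: omit_def w_def y_def translate_def)
  moreover have "omit 1 1 w = x"
    using True by (intro ext) (auto simp: omit_def w_def topspace_power_space PiE_def extensional_def)
  moreover have "differential 1 c w = 0"
    using c by (simp add: cocycles_def)
  ultimately have "c y = c x"
    by (simp add: differential_def)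
  moreover have "c y = \<rho> h (c x)"
    using c True by (simp add: y_def cocycles_def equivariant_maps_def)
  ultimately show ?thesis
    by simp
next
  case False
  then show ?thesis
    using c by (simp add: cocycles_def equivariant_maps_def continuous_maps_def)
qed

text \<open>The operators \<open>a\<close> for which \<open>c - a c\<close> is a coboundary form a
  convex set that contains \<open>\<rho> z\<close> for every central \<open>z\<close>.\<close>

lemma cocycle_minus_central_mean:
  fixes scale :: "'k::real_or_complex \<Rightarrow> 'v::banach \<Rightarrow> 'v"
    and \<rho> :: "'g::topological_group_add \<Rightarrow> 'v \<Rightarrow> 'v"
  assumes "banach_module scale \<rho>"
    and c: "c \<in> cocycles \<rho> n" and "n > 0" and a: "a \<in> banach_module.central_means \<rho>"
  shows "(\<lambda>x. c x - blinfun_apply a (c x)) \<in> coboundaries \<rho> n"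
proof -
  interpret banach_module scale \<rho>
    by fact
  show ?thesis
    using a
  proof (induction a rule: central_means_induct)
    case convex
    show ?case
      unfolding convex_def
    proof (intro ballI allI impI)
      fix a b :: "'v \<Rightarrow>\<^sub>L 'v" and s t :: real
      assume a: "a \<in> {a. (\<lambda>x. c x - blinfun_apply a (c x)) \<in> coboundaries \<rho> n}"
        and b: "b \<in> {a. (\<lambda>x. c x - blinfun_apply a (c x)) \<in> coboundaries \<rho> n}"
        and "s + t = 1"
      have "c x - blinfun_apply (s *\<^sub>R a + t *\<^sub>R b) (c x) =
          s *\<^sub>R (c x - blinfun_apply a (c x)) + t *\<^sub>R (c x - blinfun_apply b (c x))" for x
      proof -
        have "c x = s *\<^sub>R c x + t *\<^sub>R c x"
          using \<open>s + t = 1\<close> by (simp flip: scaleR_add_left)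
        then show ?thesis
          by (simp add: blinfun.add_left blinfun.scaleR_left scaleR_diff_right)
      qed
      then show "s *\<^sub>R a + t *\<^sub>R b \<in> {a. (\<lambda>x. c x - blinfun_apply a (c x)) \<in> coboundaries \<rho> n}"
        using coboundaries_lincomb[where \<rho> = \<rho> and n = n and s = s and t = t and b = "\<lambda>x. c x - blinfun_apply a (c x)"
            and c = "\<lambda>x. c x - blinfun_apply b (c x)", OF linear_rho] a b by simp
    qed
  next
    case (center z)
    then show ?case
      using cocycle_translate_cohomologous[where \<rho> = \<rho>, OF linear_rho c \<open>n > 0\<close>, of z] by simp
  qed
qed

lemma cocycles_subset_closed_coboundaries:
  fixes scale :: "'k::real_or_complex \<Rightarrow> 'v::banach \<Rightarrow> 'v"
    and \<rho> :: "'g::topological_group_add \<Rightarrow> 'v \<Rightarrow> 'v"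
  assumes "banach_module scale \<rho>" and wap: "wap_module scale \<rho>"
    and fixed: "fixed_vectors \<rho> center = {0}"
  shows "cocycles \<rho> n \<subseteq> closed_coboundaries \<rho> n"
proof
  interpret banach_module scale \<rho>
    by fact
  fix c assume c: "c \<in> cocycles \<rho> n"
  then have cont: "c \<in> continuous_maps (power_space (Suc n))"
    by (simp add: cocycles_def equivariant_maps_def)
  have "\<exists>b\<in>coboundaries \<rho> n. \<forall>x\<in>K. dist (c x) (b x) < e"
    if K: "compactin (power_space (Suc n)) K" and "e > 0" for K and e :: real
  proof (cases "n = 0")
    case True
    \<comment> \<open>In degree 0 the only coboundary is zero, so the cocycle itself has to vanish;
      it does because its values are fixed by the center.\<close>
    have "c x = 0" for x
    proof (rule ccontr)
      assume "c x \<noteq> 0"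
      then have "c x \<in> fixed_vectors \<rho> center"
        using zero_cocycle_fixed[of c \<rho> _ x] c True by (auto simp: fixed_vectors_def)
      with fixed \<open>c x \<noteq> 0\<close> show False
        by simp
    qed
    then show ?thesis
      using True \<open>e > 0\<close> by (simp add: coboundaries_def)
  next
    case False
    have "compact (c ` K)"
      using image_compactin[OF K, of euclidean c] cont by (simp add: continuous_maps_def)
    \<comment> \<open>The coboundary \<open>c - a c\<close> differs from \<open>c\<close> by
      \<open>a c\<close>, which this choice makes uniformly small on \<open>K\<close>.\<close>
    then obtain a where a: "a \<in> central_means" "\<forall>v\<in>c ` K. norm (blinfun_apply a v) < e"
      using small_central_mean[OF wap fixed _ \<open>e > 0\<close>] by blast
    have "(\<lambda>x. c x - blinfun_apply a (c x)) \<in> coboundaries \<rho> n"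
      using cocycle_minus_central_mean[OF \<open>banach_module scale \<rho>\<close> c _ a(1)] False by simp
    moreover have "\<forall>x\<in>K. dist (c x) (c x - blinfun_apply a (c x)) < e"
      using a(2) by (simp add: dist_norm)
    ultimately show ?thesis
      by (intro bexI[of _ "\<lambda>x. c x - blinfun_apply a (c x)"])
  qed
  with cont show "c \<in> closed_coboundaries \<rho> n"
    by (simp add: in_closed_coboundaries_iff)
qed

lemma coset_closed_coboundaries:
  assumes lin: "\<And>g. linear (\<rho> g)" and c: "c \<in> closed_coboundaries \<rho> n"
  shows "{\<lambda>x. c x + b x | b. b \<in> closed_coboundaries \<rho> n} = closed_coboundaries \<rho> n" (is "?L = ?R")
proof
  show "?L \<subseteq> ?R"
    using closed_coboundaries_lincomb[OF lin c, of _ 1 1] by auto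
  show "?R \<subseteq> ?L"
  proof
    fix d assume "d \<in> closed_coboundaries \<rho> n"
    then have "(\<lambda>x. d x - c x) \<in> closed_coboundaries \<rho> n"
      using closed_coboundaries_lincomb[OF lin _ c, of d 1 "- 1"] by simp
    then show "d \<in> ?L"
      by (intro CollectI exI[of _ "\<lambda>x. d x - c x"]) simp
  qed
qed

theorem corollary5:
  fixes scale :: "'k::real_or_complex \<Rightarrow> 'v::banach \<Rightarrow> 'v"
    and \<rho> :: "'g::topological_group_add \<Rightarrow> 'v \<Rightarrow> 'v"
    and n :: nat
  assumes "banach_module scale \<rho>"
    and "continuous_module \<rho>"
    and "wap_module scale \<rho>"
    and "fixed_vectors \<rho> center = {0}"
  shows "reduced_cohomology \<rho> n = {closed_coboundaries \<rho> n}"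
proof -
  interpret banach_module scale \<rho>
    by fact
  \<comment> \<open>A cocycle must exist, for otherwise the set of cosets would be empty instead of
    containing the zero coset.\<close>
  have "(\<lambda>_. 0) \<in> cocycles \<rho> n"
    using zero_mem_equivariant_maps[where \<rho> = \<rho> and m = "Suc n", OF linear_rho]
    by (auto simp: cocycles_def differential_def)
  moreover have "{\<lambda>x. c x + b x | b. b \<in> closed_coboundaries \<rho> n} = closed_coboundaries \<rho> n"
    if "c \<in> cocycles \<rho> n" for c
    using cocycles_subset_closed_coboundaries[OF assms(1,3,4)] that
    by (intro coset_closed_coboundaries linear_rho) auto
  ultimately show ?thesis
    unfolding reduced_cohomology_def by (auto simp: image_iff)
qed

end
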